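(* Let $\mathcal{A}$ be a Jacobi matrix with Jacobi parameters $(a_n)_{n\ge 0}$ (positive) and $(b_n)_{n\ge 0}$ (real), let $\breve A$ be any self-adjoint extension acting on $\ell^2(\mathbb{N}_0)$ of the Jacobi operator $A$, and let $\breve\mu$, $\nu_n$, $\eta_n$ be the associated measures. Let $(\rho_n)_{n\ge0}$ be a positive sequence tending to infinity. Then $$\lim_{n\to\infty}\Big|\mathcal{C}\big[\tfrac1{\rho_n}\nu_n\big](z)-\mathcal{C}\big[\tfrac1{\rho_n}\eta_n\big](z)\Big|=0$$ locally uniformly with respect to $z\in\mathbb{C}\setminus\mathbb{R}$, and for any integer $L\ge0$, $$\lim_{n\to\infty}\Big|\mathcal{C}\big[\tfrac1{\rho_n}\eta_{n+L}\big](z)-\mathcal{C}\big[\tfrac1{\rho_n}\eta_n\big](z)\Big|=0$$ locally uniformly with respect to $z\in\mathbb{C}\setminus\mathbb{R}$.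
   Context: The Jacobi matrix $\mathcal{A}$ is the infinite symmetric tridiagonal matrix with diagonal $b_0,b_1,\dots$ and off-diagonal $a_0,a_1,\dots$; $\mathcal{A}_n$ is its upper-left $n\times n$ truncation. The Jacobi operator $A$ is the closure in $\ell^2(\mathbb{N}_0)$ of the operator acting on finitely supported sequences by multiplication by $\mathcal{A}$; it is symmetric and always has self-adjoint extensions acting on $\ell^2(\mathbb{N}_0)$. With $E_{\breve A}$ the projection-valued spectral measure of $\breve A$ and $e_0=(1,0,0,\dots)$, $\breve\mu(\cdot)=\langle E_{\breve A}(\cdot)e_0,e_0\rangle_{\ell^2(\mathbb{N}_0)}$. The polynomials $p_n$ are $p_0\equiv1$, $p_n(z)=\frac{1}{a_0\cdots a_{n-1}}\det(z\operatorname{Id}-\mathcal{A}_n)$ for $n\ge1$; $K_n(x,y)=\sum_{k=0}^np_k(x)\overline{p_k(y)}$. Set $d\eta_n(x)=K_n(x,x)\,d\breve\mu(x)$ and $\nu_n=\sum_{y\in\sigma(\mathcal{A}_{n+1})}\delta_y$, with $\delta_y$ the Dirac measure at $y$. The Cauchy transform of a finite measure $\omega$ on $\mathbb{R}$ is $\mathcal{C}[\omega](z)=\int_{\mathbb{R}}\frac1{x-z}\,d\omega(x)$, $z\in\mathbb{C}\setminus\mathbb{R}$. *)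

theory Defs
  imports
    "HOL-Probability.Probability"
    "Jordan_Normal_Form.Spectral_Radius"
begin

section \<open>The Hilbert space of square-summable complex sequences\<close>

text \<open>
  The topology comes from the real inner product \<open>inner\<close>, the real part of the complex
  inner product \<open>cinner\<close>. The latter is linear in its first argument.
\<close>

typedef ell2 = "{x :: nat \<Rightarrow> complex. summable (\<lambda>n. (cmod (x n))\<^sup>2)}"
  morphisms coord Abs_ell2
  by (rule exI[of _ "\<lambda>_. 0"]) simp

setup_lifting type_definition_ell2

lemma summable_coord: "summable (\<lambda>n. (cmod (coord x n))\<^sup>2)"
  using coord[of x] by simp

lemma ell2_eqI: "(\<And>n. coord x n = coord y n) \<Longrightarrow> x = y"
  by (simp add: coord_inject[symmetric] fun_eq_iff)

lemma square_summable_add: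
  fixes x y :: "nat \<Rightarrow> complex"
  assumes "summable (\<lambda>n. (cmod (x n))\<^sup>2)" "summable (\<lambda>n. (cmod (y n))\<^sup>2)"
  shows "summable (\<lambda>n. (cmod (x n + y n))\<^sup>2)"
proof (rule summable_comparison_test')
  show "summable (\<lambda>n. 2 * (cmod (x n))\<^sup>2 + 2 * (cmod (y n))\<^sup>2)"
    using assms by (intro summable_add summable_mult)
  fix n
  have "(cmod (x n + y n))\<^sup>2 \<le> (cmod (x n) + cmod (y n))\<^sup>2"
    by (intro power_mono norm_triangle_ineq) simp
  also have "\<dots> \<le> 2 * (cmod (x n))\<^sup>2 + 2 * (cmod (y n))\<^sup>2"
    using zero_le_power2[of "cmod (x n) - cmod (y n)"]
    by (simp add: power2_eq_square algebra_simps)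
  finally show "norm ((cmod (x n + y n))\<^sup>2) \<le> 2 * (cmod (x n))\<^sup>2 + 2 * (cmod (y n))\<^sup>2"
    by simp
qed

lemma square_summable_mult:
  fixes x :: "nat \<Rightarrow> complex"
  assumes "summable (\<lambda>n. (cmod (x n))\<^sup>2)"
  shows "summable (\<lambda>n. (cmod (c * x n))\<^sup>2)"
  using summable_mult[OF assms, of "(cmod c)\<^sup>2"] by (simp add: norm_mult power_mult_distrib)

lift_definition scaleC_ell2 :: "complex \<Rightarrow> ell2 \<Rightarrow> ell2" is "\<lambda>c x n. c * x n"
  by (simp add: square_summable_mult)

lift_definition cinner :: "ell2 \<Rightarrow> ell2 \<Rightarrow> complex" is "\<lambda>x y. \<Sum>n. x n * cnj (y n)" .

lemma summable_cinner: "summable (\<lambda>n. coord x n * cnj (coord y n))"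
proof (rule summable_comparison_test')
  show "summable (\<lambda>n. (cmod (coord x n))\<^sup>2 + (cmod (coord y n))\<^sup>2)"
    by (intro summable_add summable_coord)
  fix n
  have "2 * (cmod (coord x n) * cmod (coord y n)) \<le> (cmod (coord x n))\<^sup>2 + (cmod (coord y n))\<^sup>2"
    using sum_squares_bound[of "cmod (coord x n)" "cmod (coord y n)"] by simp
  then show "norm (coord x n * cnj (coord y n)) \<le> (cmod (coord x n))\<^sup>2 + (cmod (coord y n))\<^sup>2"
    using mult_nonneg_nonneg[of "cmod (coord x n)" "cmod (coord y n)"]
    by (simp add: norm_mult del: mult_nonneg_nonneg)
qed

instantiation ell2 :: real_inner
begin

lift_definition zero_ell2 :: ell2 is "\<lambda>_. 0" by simp

lift_definition plus_ell2 :: "ell2 \<Rightarrow> ell2 \<Rightarrow> ell2" is "\<lambda>x y n. x n + y n"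
  by (simp add: square_summable_add)

lift_definition uminus_ell2 :: "ell2 \<Rightarrow> ell2" is "\<lambda>x n. - x n" by simp

lift_definition minus_ell2 :: "ell2 \<Rightarrow> ell2 \<Rightarrow> ell2" is "\<lambda>x y n. x n - y n"
  subgoal for x y using square_summable_add[of x "\<lambda>n. - y n"] by simp
  done

lift_definition scaleR_ell2 :: "real \<Rightarrow> ell2 \<Rightarrow> ell2" is "\<lambda>r x n. complex_of_real r * x n"
  by (simp add: square_summable_mult)

definition inner_ell2 :: "ell2 \<Rightarrow> ell2 \<Rightarrow> real" where
  "inner x y = Re (cinner x y)"

definition norm_ell2 :: "ell2 \<Rightarrow> real" where
  "norm (x :: ell2) = sqrt (inner x x)"

definition dist_ell2 :: "ell2 \<Rightarrow> ell2 \<Rightarrow> real" where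
  "dist (x :: ell2) y = norm (x - y)"

definition sgn_ell2 :: "ell2 \<Rightarrow> ell2" where
  "sgn (x :: ell2) = scaleR (inverse (norm x)) x"

definition uniformity_ell2 :: "(ell2 \<times> ell2) filter" where
  "uniformity = (INF e\<in>{0 <..}. principal {(x :: ell2, y). dist x y < e})"

definition open_ell2 :: "ell2 set \<Rightarrow> bool" where
  "open (U :: ell2 set) = (\<forall>x\<in>U. \<forall>\<^sub>F (x', y) in uniformity. x' = x \<longrightarrow> y \<in> U)"

instance
proof
  fix x y z :: ell2 and r s :: real
  note coords = plus_ell2.rep_eq zero_ell2.rep_eq minus_ell2.rep_eq uminus_ell2.rep_eq
    scaleR_ell2.rep_eq
  show "x + y + z = x + (y + z)" "x + y = y + x" "0 + x = x" "- x + x = 0" "x - y = x + - y"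
    "scaleR r (x + y) = scaleR r x + scaleR r y" "scaleR (r + s) x = scaleR r x + scaleR s x"
    "scaleR r (scaleR s x) = scaleR (r * s) x" "scaleR 1 x = x"
    by (rule ell2_eqI; simp add: coords algebra_simps)+
  have inner_sum: "inner u v = (\<Sum>n. coord u n \<bullet> coord v n)"
    and inner_summable: "summable (\<lambda>n. coord u n \<bullet> coord v n)" for u v
    using bounded_linear.suminf[OF bounded_linear_Re summable_cinner[of u v]]
      bounded_linear.summable[OF bounded_linear_Re summable_cinner[of u v]]
    by (simp_all add: inner_ell2_def cinner.rep_eq inner_complex_def)
  show "inner x y = inner y x"
    by (simp add: inner_sum inner_commute)
  show "inner (x + y) z = inner x z + inner y z"
    using inner_summable by (simp add: inner_sum coords inner_add_left suminf_add)
  have "inner (scaleR r x) y = (\<Sum>n. r * (coord x n \<bullet> coord y n))"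
    by (simp add: inner_sum coords inner_complex_def algebra_simps)
  then show "inner (scaleR r x) y = r * inner x y"
    using inner_summable by (simp add: inner_sum suminf_mult)
  show "0 \<le> inner x x"
    using inner_summable by (simp add: inner_sum suminf_nonneg)
  have "inner x x = 0 \<longleftrightarrow> (\<forall>n. coord x n \<bullet> coord x n = 0)"
    unfolding inner_sum by (rule suminf_eq_zero_iff) (use inner_summable in auto)
  also have "\<dots> \<longleftrightarrow> x = 0"
    by (auto simp: coords intro: ell2_eqI)
  finally show "inner x x = 0 \<longleftrightarrow> x = 0" .
qed (simp_all only: dist_ell2_def sgn_ell2_def norm_ell2_def uniformity_ell2_def open_ell2_def)

end

lift_definition e0 :: ell2 is "\<lambda>n. if n = 0 then 1 else 0"
  by (rule summable_finite[of "{0}"]) auto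


section \<open>Unbounded operators, represented by their graphs\<close>

definition linear_operator :: "(ell2 \<times> ell2) set \<Rightarrow> bool" where
  "linear_operator T \<longleftrightarrow>
     (0, 0) \<in> T \<and>
     (\<forall>(x, y)\<in>T. \<forall>(x', y')\<in>T. (x + x', y + y') \<in> T) \<and>
     (\<forall>c. \<forall>(x, y)\<in>T. (scaleC_ell2 c x, scaleC_ell2 c y) \<in> T) \<and>
     single_valued T"

definition adjoint_operator :: "(ell2 \<times> ell2) set \<Rightarrow> (ell2 \<times> ell2) set" where
  "adjoint_operator T = {(y, z). \<forall>(x, w)\<in>T. cinner w y = cinner x z}"

definition self_adjoint :: "(ell2 \<times> ell2) set \<Rightarrow> bool" where
  "self_adjoint T \<longleftrightarrow> linear_operator T \<and> closure (Domain T) = UNIV \<and> adjoint_operator T = T"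

definition orthogonal_projection :: "(ell2 \<Rightarrow> ell2) \<Rightarrow> bool" where
  "orthogonal_projection P \<longleftrightarrow>
     (\<forall>x y. P (x + y) = P x + P y) \<and> (\<forall>c x. P (scaleC_ell2 c x) = scaleC_ell2 c (P x)) \<and>
     (\<forall>x. P (P x) = P x) \<and> (\<forall>x y. cinner (P x) y = cinner x (P y))"

text \<open>Only the values of \<open>E\<close> on Borel sets matter.\<close>

definition projection_valued_measure :: "(real set \<Rightarrow> ell2 \<Rightarrow> ell2) \<Rightarrow> bool" where
  "projection_valued_measure E \<longleftrightarrow>
     (\<forall>S\<in>sets borel. orthogonal_projection (E S)) \<and>
     (\<forall>x. E {} x = 0) \<and> (\<forall>x. E UNIV x = x) \<and>
     (\<forall>S\<in>sets borel. \<forall>T\<in>sets borel. \<forall>x. E (S \<inter> T) x = E S (E T x)) \<and>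
     (\<forall>S :: nat \<Rightarrow> real set. range S \<subseteq> sets borel \<longrightarrow> disjoint_family S \<longrightarrow>
        (\<forall>x. (\<lambda>k. E (S k) x) sums E (\<Union>k. S k) x))"

definition scalar_spectral_measure :: "(real set \<Rightarrow> ell2 \<Rightarrow> ell2) \<Rightarrow> ell2 \<Rightarrow> real measure" where
  "scalar_spectral_measure E x =
     measure_of UNIV (sets borel) (\<lambda>S. ennreal (Re (cinner (E S x) x)))"

text \<open>
  \<open>E\<close> is the spectral measure of \<open>T\<close>, i.e. \<open>T\<close> is the integral of the identity function with
  respect to \<open>E\<close>. As usual, this integral is the operator whose domain consists of all \<open>x\<close> with
  \<open>\<integral> t\<^sup>2 d\<langle>E x, x\<rangle> < \<infinity>\<close> and whose quadratic form is \<open>\<integral> t d\<langle>E x, x\<rangle>\<close>; by polarization the form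
  determines the operator.
\<close>

definition spectral_measure_of :: "(ell2 \<times> ell2) set \<Rightarrow> (real set \<Rightarrow> ell2 \<Rightarrow> ell2) \<Rightarrow> bool" where
  "spectral_measure_of T E \<longleftrightarrow>
     projection_valued_measure E \<and>
     Domain T = {x. integrable (scalar_spectral_measure E x) (\<lambda>t. t\<^sup>2)} \<and>
     (\<forall>(x, y)\<in>T. cinner y x = complex_of_real (\<integral>t. t \<partial>scalar_spectral_measure E x))"


section \<open>Jacobi matrices and Jacobi operators\<close>

definition jacobi_matrix :: "(nat \<Rightarrow> real) \<Rightarrow> (nat \<Rightarrow> real) \<Rightarrow> nat \<Rightarrow> nat \<Rightarrow> real" where
  "jacobi_matrix a b i j =
     (if i = j then b i else if j = Suc i then a i else if i = Suc j then a j else 0)"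

definition jacobi_truncation :: "(nat \<Rightarrow> real) \<Rightarrow> (nat \<Rightarrow> real) \<Rightarrow> nat \<Rightarrow> complex mat" where
  "jacobi_truncation a b n = mat n n (\<lambda>(i, j). complex_of_real (jacobi_matrix a b i j))"

definition jacobi_operator :: "(nat \<Rightarrow> real) \<Rightarrow> (nat \<Rightarrow> real) \<Rightarrow> (ell2 \<times> ell2) set" where
  "jacobi_operator a b =
     closure {(x, y). finite {n. coord x n \<noteq> 0} \<and>
       (\<forall>i. coord y i = (\<Sum>j. complex_of_real (jacobi_matrix a b i j) * coord x j))}"

text \<open>For \<open>n = 0\<close> the empty determinant and the empty product give the constant \<open>1\<close>.\<close>

definition jacobi_poly :: "(nat \<Rightarrow> real) \<Rightarrow> (nat \<Rightarrow> real) \<Rightarrow> nat \<Rightarrow> complex \<Rightarrow> complex" where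
  "jacobi_poly a b n z =
     1 / complex_of_real (\<Prod>k<n. a k) *
     Determinant.det (z \<cdot>\<^sub>m 1\<^sub>m n - jacobi_truncation a b n)"

definition jacobi_kernel ::
    "(nat \<Rightarrow> real) \<Rightarrow> (nat \<Rightarrow> real) \<Rightarrow> nat \<Rightarrow> complex \<Rightarrow> complex \<Rightarrow> complex" where
  "jacobi_kernel a b n x y = (\<Sum>k\<le>n. jacobi_poly a b k x * cnj (jacobi_poly a b k y))"


section \<open>The measures and their Cauchy transforms\<close>

definition spectral_measure_e0 :: "(real set \<Rightarrow> ell2 \<Rightarrow> ell2) \<Rightarrow> real measure" where
  "spectral_measure_e0 E = scalar_spectral_measure E e0"

text \<open>The kernel is real and non-negative on the diagonal, so \<open>Re\<close> and \<open>ennreal\<close> lose nothing.\<close>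

definition eta_measure ::
    "(nat \<Rightarrow> real) \<Rightarrow> (nat \<Rightarrow> real) \<Rightarrow> (real set \<Rightarrow> ell2 \<Rightarrow> ell2) \<Rightarrow> nat \<Rightarrow> real measure" where
  "eta_measure a b E n =
     density (spectral_measure_e0 E)
       (\<lambda>x. ennreal (Re (jacobi_kernel a b n (complex_of_real x) (complex_of_real x))))"

text \<open>The spectrum of the truncation is real, so no eigenvalue is lost below.\<close>

definition nu_measure :: "(nat \<Rightarrow> real) \<Rightarrow> (nat \<Rightarrow> real) \<Rightarrow> nat \<Rightarrow> real measure" where
  "nu_measure a b n =
     measure_of UNIV (sets borel)
       (\<lambda>S. \<Sum>y\<in>{y. complex_of_real y \<in> spectrum (jacobi_truncation a b (Suc n))}.
              emeasure (return borel y) S)"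

definition cauchy_transform :: "real measure \<Rightarrow> complex \<Rightarrow> complex" where
  "cauchy_transform \<omega> z = (\<integral>x. 1 / (complex_of_real x - z) \<partial>\<omega>)"

definition locally_uniform_limit ::
    "'a::topological_space set \<Rightarrow> ('i \<Rightarrow> 'a \<Rightarrow> 'b::metric_space) \<Rightarrow> ('a \<Rightarrow> 'b) \<Rightarrow> 'i filter \<Rightarrow> bool"
  where
  "locally_uniform_limit S f l F \<longleftrightarrow>
     (\<forall>z\<in>S. \<exists>U. open U \<and> z \<in> U \<and> uniform_limit (U \<inter> S) f l F)"

end

theory Submission
  imports Defs
begin

text \<open>
  Without the factor \<open>1 / \<rho> n\<close>, both differences are bounded uniformly in \<open>n\<close>: the first by
  \<open>1 / \<bar>Im z\<bar>\<close> and the second by \<open>L / \<bar>Im z\<bar>\<close>. Dividing by \<open>\<rho> n\<close> therefore sends them to \<open>0\<close>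
  locally uniformly off the real line. Here is why the bounds hold.

  Let \<open>\<mu>\<close> be the spectral measure at \<open>e0\<close> and \<open>G\<^sub>j\<^sub>k(z) = \<integral> p\<^sub>j p\<^sub>k / (x - z) d\<mu>\<close> the Green function,
  that is, the matrix of the resolvent of the self-adjoint extension in the standard basis. The
  transform of \<open>\<eta>\<^sub>n\<close> is the partial trace \<open>\<Sum>k\<le>n. G\<^sub>k\<^sub>k\<close>. Each \<open>p\<^sub>k\<close> has norm \<open>1\<close> in \<open>L\<^sup>2(\<mu>)\<close>, so
  \<open>\<bar>G\<^sub>k\<^sub>k\<bar> \<le> 1 / \<bar>Im z\<bar>\<close>, which is the second bound. The transform of \<open>\<nu>\<^sub>n\<close> is \<open>- p'\<^sub>n\<^sub>+\<^sub>1 / p\<^sub>n\<^sub>+\<^sub>1\<close>,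
  because the eigenvalues of the truncation are the zeros of \<open>p\<^sub>n\<^sub>+\<^sub>1\<close>, all simple and real.

  The partial trace of the resolvent and the trace of the resolvent of the truncation differ by a
  rank one term. Explicitly, orthogonality gives \<open>G\<^sub>j\<^sub>k = p\<^sub>j(z) q\<^sub>k\<close> for \<open>j \<le> k\<close>, where
  \<open>q\<^sub>k = G\<^sub>0\<^sub>k\<close>, and three instances of the Lagrange identity for the three-term recurrence turn the
  difference into \<open>- (q\<^sub>n\<^sub>+\<^sub>1 / p\<^sub>n\<^sub>+\<^sub>1) \<Sum>k\<le>n. p\<^sub>k\<^sup>2\<close> (lemma \<open>trace_difference\<close>). Put
  \<open>S = \<Sum>k\<le>n. \<bar>p\<^sub>k\<bar>\<^sup>2\<close>. Bessel's inequality for \<open>p\<^sub>n\<^sub>+\<^sub>1(x) / (x - z)\<close>, whose coefficients are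
  \<open>p\<^sub>k(z) q\<^sub>n\<^sub>+\<^sub>1\<close>, reads \<open>\<bar>q\<^sub>n\<^sub>+\<^sub>1\<bar>\<^sup>2 S \<le> Im (p\<^sub>n\<^sub>+\<^sub>1 q\<^sub>n\<^sub>+\<^sub>1) / Im z \<le> \<bar>p\<^sub>n\<^sub>+\<^sub>1\<bar> \<bar>q\<^sub>n\<^sub>+\<^sub>1\<bar> / \<bar>Im z\<bar>\<close>.
  Cancelling one factor \<open>\<bar>q\<^sub>n\<^sub>+\<^sub>1\<bar>\<close> is exactly the first bound (\<open>cauchy_transform_nu_eta_bound\<close>).

  The operator enters through the orthonormality of the \<open>p\<^sub>k\<close> in \<open>L\<^sup>2(\<mu>)\<close> (\<open>jacobi_orthonormal_spectral_measure\<close>). As the spectral theorem enters solely through domains and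
  quadratic forms, a piece of functional calculus has to be recovered: \<open>d\<mu>\<^sub>T\<^sub>x = t\<^sup>2 d\<mu>\<^sub>x\<close> for \<open>x\<close> in the
  domain of \<open>T\<close> (\<open>mu_image\<close>). It yields all moments of \<open>\<mu>\<close>, and the recurrence carries these over
  to the inner products of the \<open>p\<^sub>k\<close>.
\<close>

section \<open>The three-term recurrence\<close>

text \<open>
  The formal action of the Jacobi matrix on sequences. The values range over a real vector space
  because the same recurrence governs the polynomials, their derivatives, integrals against them, and
  the standard basis vectors themselves.
\<close>

definition jacobi_action ::
    "(nat \<Rightarrow> real) \<Rightarrow> (nat \<Rightarrow> real) \<Rightarrow> (nat \<Rightarrow> 'v::real_vector) \<Rightarrow> nat \<Rightarrow> 'v" where
  "jacobi_action a b f k =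
     a k *\<^sub>R f (Suc k) + b k *\<^sub>R f k + (if k = 0 then 0 else a (k - 1) *\<^sub>R f (k - 1))"

lemma jacobi_action_0: "jacobi_action a b f 0 = a 0 *\<^sub>R f 1 + b 0 *\<^sub>R f 0"
  and jacobi_action_Suc: "jacobi_action a b f (Suc k)
      = a (Suc k) *\<^sub>R f (Suc (Suc k)) + b (Suc k) *\<^sub>R f (Suc k) + a k *\<^sub>R f k"
  by (simp_all add: jacobi_action_def)

lemma jacobi_action_integral:
  fixes F :: "nat \<Rightarrow> 'a \<Rightarrow> 'b :: {banach, second_countable_topology}"
  assumes "\<And>k. integrable M (F k)"
  shows "jacobi_action a b (\<lambda>k. \<integral>x. F k x \<partial>M) k = (\<integral>x. jacobi_action a b (\<lambda>k. F k x) k \<partial>M)"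
  using assms by (cases "k = 0") (simp_all add: jacobi_action_def)

text \<open>
  Summation by parts: the interior off-diagonal terms telescope because the matrix is symmetric. Every
  identity of Christoffel--Darboux or Wronskian type below is an instance.
\<close>

lemma lagrange_identity:
  fixes f g :: "nat \<Rightarrow> 'a :: real_field"
  shows "(\<Sum>k\<le>n. jacobi_action a b f k * g k - f k * jacobi_action a b g k)
    = a n *\<^sub>R (f (Suc n) * g n - f n * g (Suc n))"
  by (induction n) (simp_all add: jacobi_action_0 jacobi_action_Suc algebra_simps)

text \<open>
  The polynomials \<open>p\<^sub>k\<close>, obtained by solving the recurrence instead of from determinants. Real
  coefficients are what is integrated; derivatives and zeros are taken after the embedding into complex
  polynomials.
\<close>

fun orth_poly :: "(nat \<Rightarrow> real) \<Rightarrow> (nat \<Rightarrow> real) \<Rightarrow> nat \<Rightarrow> real poly" where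
  "orth_poly a b 0 = 1"
| "orth_poly a b (Suc 0) = Polynomial.smult (1 / a 0) [:- b 0, 1:]"
| "orth_poly a b (Suc (Suc k)) = Polynomial.smult (1 / a (Suc k))
     ([:- b (Suc k), 1:] * orth_poly a b (Suc k) - Polynomial.smult (a k) (orth_poly a b k))"

abbreviation orth_cpoly :: "(nat \<Rightarrow> real) \<Rightarrow> (nat \<Rightarrow> real) \<Rightarrow> nat \<Rightarrow> complex poly" where
  "orth_cpoly a b k \<equiv> map_poly complex_of_real (orth_poly a b k)"

lemma map_poly_of_real_simps:
  "map_poly complex_of_real (p + q) = map_poly complex_of_real p + map_poly complex_of_real q"
  "map_poly complex_of_real (p - q) = map_poly complex_of_real p - map_poly complex_of_real q"
  "map_poly complex_of_real (p * q) = map_poly complex_of_real p * map_poly complex_of_real q"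
  "map_poly complex_of_real (Polynomial.smult r p)
     = Polynomial.smult (complex_of_real r) (map_poly complex_of_real p)"
  by (rule poly_eqI; simp add: coeff_map_poly coeff_mult)+

lemma orth_cpoly_Suc_Suc:
  "orth_cpoly a b (Suc (Suc k)) = Polynomial.smult (complex_of_real (1 / a (Suc k)))
     ([:- complex_of_real (b (Suc k)), 1:] * orth_cpoly a b (Suc k)
       - Polynomial.smult (complex_of_real (a k)) (orth_cpoly a b k))"
  and orth_cpoly_1: "orth_cpoly a b (Suc 0)
     = Polynomial.smult (complex_of_real (1 / a 0)) [:- complex_of_real (b 0), 1:]"
  by (simp_all only: orth_poly.simps map_poly_of_real_simps) (simp_all add: map_poly_pCons)

locale jacobi_parameters =
  fixes a b :: "nat \<Rightarrow> real"
  assumes a_pos: "a k > 0"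
begin

text \<open>
  The entries \<open>a k\<close> do not vanish, so the value at \<open>Suc k\<close> can be read off from the recurrence. Two
  sequences are thus compared by comparing their initial values and the action on them.
\<close>

lemma jacobi_action_step:
  assumes "jacobi_action a b f k = jacobi_action a b g k"
    and "f k = g k" and "k \<noteq> 0 \<Longrightarrow> f (k - 1) = g (k - 1)"
  shows "f (Suc k) = g (Suc k)"
proof -
  have "a k *\<^sub>R f (Suc k) = a k *\<^sub>R g (Suc k)"
    using assms by (cases "k = 0") (simp_all add: jacobi_action_def)
  then show ?thesis
    using a_pos[of k] by simp
qed

lemma jacobi_action_unique:
  fixes f g :: "nat \<Rightarrow> 'a :: real_field"
  assumes "f 0 = g 0"
    and f: "\<And>k. k < n \<Longrightarrow> jacobi_action a b f k = z * f k"
    and g: "\<And>k. k < n \<Longrightarrow> jacobi_action a b g k = z * g k"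
  shows "k \<le> n \<Longrightarrow> f k = g k"
proof (induction k rule: less_induct)
  case (less k)
  show ?case
  proof (cases k)
    case (Suc j)
    have fg: "f i = g i" if "i \<le> j" for i
      using less that Suc by simp
    have "jacobi_action a b f j = jacobi_action a b g j"
      using f[of j] g[of j] fg[of j] less.prems Suc by simp
    then show ?thesis
      unfolding Suc by (rule jacobi_action_step) (simp_all add: fg)
  qed (use assms(1) in simp)
qed

lemma orth_poly_recurrence:
  shows "jacobi_action a b (\<lambda>k. poly (orth_poly a b k) x) k = x * poly (orth_poly a b k) x"
proof (cases k)
  case 0
  then show ?thesis
    using a_pos[of 0] by (simp add: jacobi_action_0 field_simps)
next
  case (Suc j)
  then show ?thesis
    using a_pos[of k] by (simp add: jacobi_action_Suc field_simps)
qed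

lemma orth_cpoly_recurrence:
  shows "jacobi_action a b (\<lambda>k. poly (orth_cpoly a b k) z) k = z * poly (orth_cpoly a b k) z"
proof (cases k)
  case 0
  then show ?thesis
    using a_pos[of 0] by (simp add: jacobi_action_0 orth_cpoly_1 scaleR_conv_of_real field_simps)
next
  case (Suc j)
  then show ?thesis
    using a_pos[of k]
    by (simp add: jacobi_action_Suc orth_cpoly_Suc_Suc scaleR_conv_of_real field_simps
        del: orth_poly.simps)
qed

lemma orth_cpoly_pderiv_recurrence:
  shows "jacobi_action a b (\<lambda>k. poly (pderiv (orth_cpoly a b k)) z) k
     = z * poly (pderiv (orth_cpoly a b k)) z + poly (orth_cpoly a b k) z"
proof (cases k)
  case 0
  then show ?thesis
    using a_pos[of 0] by (simp add: jacobi_action_0 orth_cpoly_1 scaleR_conv_of_real pderiv_smult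
        pderiv_pCons field_simps)
next
  case (Suc j)
  then show ?thesis
    using a_pos[of k]
    by (simp add: jacobi_action_Suc orth_cpoly_Suc_Suc scaleR_conv_of_real pderiv_smult pderiv_mult
        pderiv_diff pderiv_add pderiv_pCons field_simps del: orth_poly.simps)
qed

text \<open>
  Expansion along the last row leaves two minors. The one that is not a truncation again has a last
  column with the single entry \<open>- a n\<close>, along which it is expanded once more.
\<close>

lemma jacobi_det_recurrence:
  fixes z :: complex
  defines "D \<equiv> \<lambda>n. Determinant.det (z \<cdot>\<^sub>m 1\<^sub>m n - jacobi_truncation a b n)"
  shows "D (Suc (Suc n)) = (z - complex_of_real (b (Suc n))) * D (Suc n) - (complex_of_real (a n))\<^sup>2 * D n"
proof -
  define M where "M n = z \<cdot>\<^sub>m 1\<^sub>m n - jacobi_truncation a b n" for n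
  have M: "M n \<in> carrier_mat n n" for n
    unfolding M_def jacobi_truncation_def by (rule minus_carrier_mat) simp
  have entry: "M m $$ (i, j) = (if i = j then z else 0) - complex_of_real (jacobi_matrix a b i j)"
    if "i < m" "j < m" for m i j
    using that by (simp add: M_def jacobi_truncation_def)
  have dim: "dim_row (M m) = m" "dim_col (M m) = m" for m
    using M[of m] by auto
  define B where "B = mat_delete (M (Suc (Suc n))) (Suc n) n"
  have B: "B \<in> carrier_mat (Suc n) (Suc n)"
    by (simp add: B_def mat_delete_def dim)
  have "det B = (\<Sum>i<Suc n. B $$ (i, n) * cofactor B i n)"
    by (rule laplace_expansion_column[OF B]) simp
  also have "\<dots> = (\<Sum>i<Suc n. if i = n then - complex_of_real (a n) * cofactor B n n else 0)"
    by (intro sum.cong) (auto simp: B_def mat_delete_def dim entry jacobi_matrix_def)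
  also have "\<dots> = - complex_of_real (a n) * cofactor B n n"
    by simp
  also have "cofactor B n n = det (M n)"
  proof -
    have "mat_delete B n n = M n"
      by (rule eq_matI) (auto simp: B_def mat_delete_def dim entry)
    then show ?thesis by (simp add: cofactor_def)
  qed
  finally have detB: "det B = - complex_of_real (a n) * det (M n)" .
  have "det (M (Suc (Suc n)))
      = (\<Sum>j<Suc (Suc n). M (Suc (Suc n)) $$ (Suc n, j) * cofactor (M (Suc (Suc n))) (Suc n) j)"
    by (rule laplace_expansion_row[OF M]) simp
  also have "\<dots> = (\<Sum>j<Suc (Suc n). if j = n then - complex_of_real (a n) * cofactor (M (Suc (Suc n))) (Suc n) n
      else if j = Suc n then (z - complex_of_real (b (Suc n))) * cofactor (M (Suc (Suc n))) (Suc n) (Suc n) else 0)"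
    by (intro sum.cong) (auto simp: entry jacobi_matrix_def)
  also have "\<dots> = - complex_of_real (a n) * cofactor (M (Suc (Suc n))) (Suc n) n
      + (z - complex_of_real (b (Suc n))) * cofactor (M (Suc (Suc n))) (Suc n) (Suc n)"
    by simp
  also have "cofactor (M (Suc (Suc n))) (Suc n) (Suc n) = det (M (Suc n))"
  proof -
    have "mat_delete (M (Suc (Suc n))) (Suc n) (Suc n) = M (Suc n)"
      by (rule eq_matI) (auto simp: mat_delete_def dim entry)
    then show ?thesis by (simp add: cofactor_def)
  qed
  also have "cofactor (M (Suc (Suc n))) (Suc n) n = - det B"
    by (simp add: cofactor_def B_def)
  finally show ?thesis
    by (simp add: detB power2_eq_square D_def flip: M_def)
qed

theorem jacobi_poly_eq_orth_cpoly:
  shows "jacobi_poly a b n z = poly (orth_cpoly a b n) z"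
proof (rule jacobi_action_unique[where z = z and n = n])
  define D where "D n = Determinant.det (z \<cdot>\<^sub>m 1\<^sub>m n - jacobi_truncation a b n)" for n
  define A where "A n = complex_of_real (\<Prod>k<n. a k)" for n
  have A: "A n \<noteq> 0" "A (Suc n) = complex_of_real (a n) * A n" for n
    using a_pos by (simp_all add: A_def prod_zero_iff less_imp_neq[symmetric])
  have a0: "complex_of_real (a k) \<noteq> 0" for k
    using a_pos[of k] by simp
  have jp: "jacobi_poly a b n z = D n / A n" for n
    by (simp add: jacobi_poly_def D_def A_def)
  have D0: "D 0 = 1"
    unfolding D_def by (intro det_dim_zero minus_carrier_mat) (simp add: jacobi_truncation_def)
  have D1: "D (Suc 0) = z - complex_of_real (b 0)"
    unfolding D_def by (subst det_single) (auto simp: jacobi_truncation_def jacobi_matrix_def)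
  show "jacobi_action a b (\<lambda>n. jacobi_poly a b n z) k = z * jacobi_poly a b k z" for k
  proof (cases k)
    case 0
    then show ?thesis
      using a0 by (simp add: jacobi_action_0 jp D0 D1 A A_def scaleR_conv_of_real field_simps)
  next
    case (Suc j)
    have "D (Suc (Suc j)) = (z - complex_of_real (b (Suc j))) * D (Suc j) - (complex_of_real (a j))\<^sup>2 * D j"
      unfolding D_def by (rule jacobi_det_recurrence)
    then show ?thesis
      using a0[of j] a0[of "Suc j"] A(1)[of j] Suc
      by (simp add: jacobi_action_Suc jp A(2) scaleR_conv_of_real power2_eq_square divide_simps)
        (simp add: algebra_simps)
  qed
  show "jacobi_poly a b 0 z = poly (orth_cpoly a b 0) z"
    by (simp add: jp D0 A_def)
qed (simp_all add: orth_cpoly_recurrence)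

lemma orth_cpoly_of_real:
  "poly (orth_cpoly a b k) (complex_of_real x) = complex_of_real (poly (orth_poly a b k) x)"
proof -
  have "poly (map_poly complex_of_real p) (complex_of_real x) = complex_of_real (poly p x)" for p
    by (induction p) (auto simp: map_poly_pCons)
  then show ?thesis .
qed

lemma cnj_orth_cpoly: "cnj (poly (orth_cpoly a b k) z) = poly (orth_cpoly a b k) (cnj z)"
  by (simp add: poly_cnj_real coeff_map_poly)

text \<open>
  At a zero of \<open>p\<^sub>n\<close> the Lagrange identity for \<open>p\<close> and its conjugate has a vanishing right-hand side,
  while the left-hand side is \<open>(z - cnj z)\<close> times a sum of squares that is at least \<open>\<bar>p\<^sub>0\<bar>\<^sup>2 = 1\<close>.
\<close>

lemma orth_cpoly_nonzero:
  assumes "Im z \<noteq> 0"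
  shows "poly (orth_cpoly a b n) z \<noteq> 0"
proof (cases n)
  case (Suc m)
  define p where "p k = poly (orth_cpoly a b k) z" for k
  have "(\<Sum>k\<le>m. (z - cnj z) * (p k * cnj (p k)))
      = a m *\<^sub>R (p (Suc m) * cnj (p m) - p m * cnj (p (Suc m)))"
    using lagrange_identity[of a b p "\<lambda>k. cnj (p k)" m] orth_cpoly_recurrence
    by (simp add: p_def[abs_def] cnj_orth_cpoly algebra_simps)
  also have "(\<Sum>k\<le>m. (z - cnj z) * (p k * cnj (p k)))
      = (z - cnj z) * complex_of_real (\<Sum>k\<le>m. (cmod (p k))\<^sup>2)"
    by (simp add: sum_distrib_left complex_norm_square del: of_real_power)
  finally have *: "(z - cnj z) * complex_of_real (\<Sum>k\<le>m. (cmod (p k))\<^sup>2)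
      = a m *\<^sub>R (p (Suc m) * cnj (p m) - p m * cnj (p (Suc m)))" .
  have "(cmod (p 0))\<^sup>2 \<le> (\<Sum>k\<le>m. (cmod (p k))\<^sup>2)"
    by (rule member_le_sum) auto
  then have "(\<Sum>k\<le>m. (cmod (p k))\<^sup>2) \<noteq> 0"
    by (auto simp: p_def)
  moreover have "z - cnj z \<noteq> 0"
    using assms by (simp add: complex_eq_iff)
  ultimately have "(z - cnj z) * complex_of_real (\<Sum>k\<le>m. (cmod (p k))\<^sup>2) \<noteq> 0"
    by (simp only: mult_eq_0_iff of_real_eq_0_iff) auto
  then show ?thesis
    using * Suc by (auto simp: p_def simp del: of_real_sum)
qed simp

text \<open>
  Differentiating the recurrence adds the inhomogeneity \<open>p\<^sub>k\<close>, which the Lagrange identity for \<open>p'\<close>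
  and \<open>p\<close> collects.
\<close>

lemma christoffel_darboux_confluent:
  shows "(\<Sum>k\<le>n. (poly (orth_cpoly a b k) z)\<^sup>2)
    = a n *\<^sub>R (poly (pderiv (orth_cpoly a b (Suc n))) z * poly (orth_cpoly a b n) z
        - poly (pderiv (orth_cpoly a b n)) z * poly (orth_cpoly a b (Suc n)) z)"
proof -
  have *: "(z * d + p) * p - d * (z * p) = p\<^sup>2" for d p
    by (simp add: power2_eq_square algebra_simps)
  show ?thesis
    using lagrange_identity[of a b "\<lambda>k. poly (pderiv (orth_cpoly a b k)) z"
        "\<lambda>k. poly (orth_cpoly a b k) z" n]
    by (simp only: orth_cpoly_recurrence orth_cpoly_pderiv_recurrence *)
qed

text \<open>
  A multiple zero would be real, and there the confluent Christoffel--Darboux sum is a sum of real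
  squares that starts with \<open>1\<close>.
\<close>

lemma rsquarefree_orth_cpoly:
  shows "rsquarefree (orth_cpoly a b (Suc n))"
  unfolding rsquarefree_roots
proof (intro allI notI)
  fix z assume z: "poly (orth_cpoly a b (Suc n)) z = 0 \<and> poly (pderiv (orth_cpoly a b (Suc n))) z = 0"
  then have "Im z = 0"
    using orth_cpoly_nonzero by blast
  then have "z = complex_of_real (Re z)"
    by (simp add: complex_eq_iff)
  then have "(\<Sum>k\<le>n. (poly (orth_cpoly a b k) z)\<^sup>2)
      = complex_of_real (\<Sum>k\<le>n. (poly (orth_poly a b k) (Re z))\<^sup>2)"
    by (metis (no_types, lifting) of_real_power of_real_sum orth_cpoly_of_real sum.cong)
  moreover have "(poly (orth_poly a b 0) (Re z))\<^sup>2 \<le> (\<Sum>k\<le>n. (poly (orth_poly a b k) (Re z))\<^sup>2)"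
    by (rule member_le_sum) auto
  ultimately have "(\<Sum>k\<le>n. (poly (orth_cpoly a b k) z)\<^sup>2) \<noteq> 0"
    by (auto simp del: of_real_sum)
  then show False
    using christoffel_darboux_confluent[of z n] z by simp
qed

lemma log_derivative:
  fixes p :: "complex poly"
  assumes "rsquarefree p" and z: "poly p z \<noteq> 0"
  shows "poly (pderiv p) z / poly p z = (\<Sum>w | poly p w = 0. 1 / (z - w))"
proof -
  define R where "R = {w. poly p w = 0}"
  define q where "q = (\<Prod>w\<in>R. [:- w, 1:])"
  have p: "Polynomial.smult (lead_coeff p) q = p"
    unfolding q_def R_def using assms(1) by (rule complex_poly_decompose_rsquarefree)
  have [simp]: "finite R"
    unfolding R_def using z by (intro poly_roots_finite) auto
  have q: "poly q z = (\<Prod>w\<in>R. z - w)"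
    by (simp add: q_def poly_prod)
  have "lead_coeff p \<noteq> 0" "poly q z \<noteq> 0"
    using z p by (metis poly_smult mult_zero_left, metis poly_smult mult_zero_right)
  then have "poly (pderiv p) z / poly p z = poly (pderiv q) z / poly q z"
    by (subst (1 2) p[symmetric]) (simp add: pderiv_smult)
  also have "poly (pderiv q) z = (\<Sum>w\<in>R. \<Prod>v\<in>R - {w}. z - v)"
    by (simp add: q_def pderiv_prod poly_sum poly_prod pderiv_pCons)
  also have "\<dots> / poly q z = (\<Sum>w\<in>R. 1 / (z - w))"
    unfolding sum_divide_distrib q
  proof (rule sum.cong)
    fix w assume w: "w \<in> R"
    have "z - w \<noteq> 0" using w z by (auto simp: R_def)
    moreover have "(\<Prod>v\<in>R - {w}. z - v) \<noteq> 0"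
      using z \<open>finite R\<close> by (simp add: prod_zero_iff) (auto simp: R_def)
    ultimately show "(\<Prod>v\<in>R - {w}. z - v) / (\<Prod>v\<in>R. z - v) = 1 / (z - w)"
      using prod.remove[OF \<open>finite R\<close> w, of "\<lambda>v. z - v"] by simp
  qed simp
  finally show ?thesis by (simp add: R_def)
qed

lemma spectrum_jacobi_truncation:
  shows "spectrum (jacobi_truncation a b n) = {z. poly (orth_cpoly a b n) z = 0}"
proof -
  have carrier: "jacobi_truncation a b n \<in> carrier_mat n n"
    by (simp add: jacobi_truncation_def)
  have "(\<Prod>k<n. a k) \<noteq> 0"
    using a_pos by (simp add: less_imp_neq[symmetric])
  then have *: "jacobi_poly a b n z = 0 \<longleftrightarrow> Determinant.det (z \<cdot>\<^sub>m 1\<^sub>m n - jacobi_truncation a b n) = 0" for z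
    unfolding jacobi_poly_def by (simp del: of_real_prod)
  have "z \<cdot>\<^sub>m 1\<^sub>m n - jacobi_truncation a b n = (- 1) \<cdot>\<^sub>m char_matrix (jacobi_truncation a b n) z" for z
    by (rule eq_matI) (auto simp: char_matrix_def jacobi_truncation_def)
  then have "Determinant.det (z \<cdot>\<^sub>m 1\<^sub>m n - jacobi_truncation a b n) = 0
      \<longleftrightarrow> Determinant.det (char_matrix (jacobi_truncation a b n) z) = 0" for z
    by simp
  then show ?thesis
    by - (rule Set.set_eqI, simp only: spectrum_def mem_Collect_eq eigenvalue_det[OF carrier]
        jacobi_poly_eq_orth_cpoly[symmetric] *)
qed

text \<open>
  As the push-forward of a counting measure, \<open>nu_measure\<close> is seen to be a measure on the Borel sets,
  and integrals against it become finite sums.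
\<close>

lemma nu_measure_eq_distr:
  defines "Y n \<equiv> {y. complex_of_real y \<in> spectrum (jacobi_truncation a b (Suc n))}"
  shows "nu_measure a b n = distr (count_space (Y n)) borel (\<lambda>y. y)"
proof -
  have carrier: "jacobi_truncation a b (Suc n) \<in> carrier_mat (Suc n) (Suc n)"
    by (simp add: jacobi_truncation_def)
  have "complex_of_real ` Y n \<subseteq> spectrum (jacobi_truncation a b (Suc n))"
    by (auto simp: Y_def)
  then have fin: "finite (Y n)"
    using card_finite_spectrum(1)[OF carrier] finite_subset
    by (metis finite_imageD inj_on_def of_real_eq_iff)
  let ?M = "distr (count_space (Y n)) borel (\<lambda>y. y)"
  have "nu_measure a b n = measure_of (space ?M) (sets ?M) (emeasure ?M)"
    unfolding nu_measure_def
  proof (simp, rule measure_of_eq)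
    fix S assume "S \<in> sigma_sets UNIV (sets (borel :: real measure))"
    then have S: "S \<in> sets (borel :: real measure)"
      using sets.sigma_sets_eq[of "borel :: real measure"] by simp
    have "emeasure ?M S = emeasure (count_space (Y n)) (S \<inter> Y n)"
      using S by (simp add: emeasure_distr)
    also have "\<dots> = (\<Sum>y\<in>Y n. indicator S y)"
      using fin by (simp add: indicator_def sum.If_cases Int_commute)
    also have "\<dots> = (\<Sum>y\<in>Y n. emeasure (return borel y) S)"
      using S by simp
    finally show "(\<Sum>y\<in>{y. complex_of_real y \<in> spectrum (jacobi_truncation a b (Suc n))}.
        emeasure (return borel y) S) = emeasure ?M S"
      by (simp add: Y_def)
  qed simp
  then show ?thesis by (simp only: measure_of_of_measure)
qed

theorem cauchy_transform_nu:
  assumes z: "Im z \<noteq> 0"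
  shows "cauchy_transform (nu_measure a b n) z
    = - poly (pderiv (orth_cpoly a b (Suc n))) z / poly (orth_cpoly a b (Suc n)) z"
proof -
  let ?Q = "orth_cpoly a b (Suc n)"
  define Y where "Y = {y. complex_of_real y \<in> spectrum (jacobi_truncation a b (Suc n))}"
  have nz: "poly ?Q z \<noteq> 0"
    by (rule orth_cpoly_nonzero[OF z])
  then have fin: "finite {w. poly ?Q w = 0}"
    by (intro poly_roots_finite) auto
  have roots: "{w. poly ?Q w = 0} = complex_of_real ` Y"
  proof (intro equalityI subsetI)
    fix w assume w: "w \<in> {w. poly ?Q w = 0}"
    then have "Im w = 0"
      using orth_cpoly_nonzero by blast
    then have "w = complex_of_real (Re w)"
      by (simp add: complex_eq_iff)
    with w show "w \<in> complex_of_real ` Y"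
      unfolding Y_def spectrum_jacobi_truncation by (metis (mono_tags) image_eqI mem_Collect_eq)
  qed (use spectrum_jacobi_truncation in \<open>auto simp: Y_def\<close>)
  have finY: "finite Y"
    using fin unfolding roots by (rule finite_imageD) (simp add: inj_on_def)
  have "cauchy_transform (nu_measure a b n) z = (\<Sum>y\<in>Y. 1 / (complex_of_real y - z))"
    unfolding cauchy_transform_def nu_measure_eq_distr Y_def[symmetric]
    by (subst integral_distr) (auto simp: lebesgue_integral_count_space_finite finY)
  also have "\<dots> = - (\<Sum>w | poly ?Q w = 0. 1 / (z - w))"
    unfolding roots by (subst sum.reindex)
      (auto simp: inj_on_def sum_negf[symmetric] minus_divide_right intro!: sum.cong)
  also have "\<dots> = - poly (pderiv ?Q) z / poly ?Q z"
    using log_derivative[OF rsquarefree_orth_cpoly nz] by simp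
  finally show ?thesis .
qed

end

section \<open>The Green function of an orthonormalizing measure\<close>

text \<open>
  The interface between operator theory and the Cauchy transforms, which are estimated through the
  \<open>p\<^sub>k\<close> as an orthonormal system in \<open>L\<^sup>2(M)\<close>.
\<close>

locale jacobi_orthonormal = jacobi_parameters a b for a b :: "nat \<Rightarrow> real" +
  fixes M :: "real measure"
  assumes sets_M [simp, measurable_cong]: "sets M = sets borel"
    and integrable_orth: "integrable M (\<lambda>x. poly (orth_poly a b j) x * poly (orth_poly a b k) x)"
    and orthonormal: "(\<integral>x. poly (orth_poly a b j) x * poly (orth_poly a b k) x \<partial>M) = (if j = k then 1 else 0)"
begin

text \<open>
  When \<open>M\<close> is the spectral measure, these are the matrix entries of the resolvent at \<open>z\<close>.
\<close>

definition green :: "complex \<Rightarrow> nat \<Rightarrow> nat \<Rightarrow> complex" where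
  "green z j k = (\<integral>x. complex_of_real (poly (orth_poly a b j) x * poly (orth_poly a b k) x)
     / (complex_of_real x - z) \<partial>M)"

lemma measurable_orth [measurable]: "(\<lambda>x. poly (orth_poly a b k) x) \<in> borel_measurable borel"
  by (intro borel_measurable_continuous_onI continuous_intros)

lemma norm_kernel_bound:
  assumes "Im z \<noteq> 0"
  shows "cmod (complex_of_real r / (complex_of_real x - z)) \<le> \<bar>r\<bar> / \<bar>Im z\<bar>"
proof -
  have "\<bar>Im z\<bar> \<le> cmod (complex_of_real x - z)"
    using abs_Im_le_cmod[of "complex_of_real x - z"] by simp
  then show ?thesis
    using assms by (simp add: norm_divide frac_le)
qed

lemma integrable_green:
  assumes "Im z \<noteq> 0"
  shows "integrable M (\<lambda>x. complex_of_real (poly (orth_poly a b j) x * poly (orth_poly a b k) x)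
     / (complex_of_real x - z))"
proof (rule Bochner_Integration.integrable_bound)
  show "integrable M (\<lambda>x. poly (orth_poly a b j) x * poly (orth_poly a b k) x / \<bar>Im z\<bar>)"
    using integrable_orth by simp
  show "AE x in M. cmod (complex_of_real (poly (orth_poly a b j) x * poly (orth_poly a b k) x)
      / (complex_of_real x - z)) \<le> norm (poly (orth_poly a b j) x * poly (orth_poly a b k) x / \<bar>Im z\<bar>)"
    using norm_kernel_bound[OF assms] by (intro AE_I2) (simp only: real_norm_def abs_divide abs_idempotent)
qed measurable

lemma green_sym: "green z j k = green z k j"
  by (simp add: green_def mult.commute)

text \<open>
  Write \<open>x / (x - z) = 1 + z / (x - z)\<close>; the first summand contributes the orthonormality relation.
\<close>

lemma green_recurrence:
  assumes z: "Im z \<noteq> 0"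
  shows "jacobi_action a b (green z j) k = (if j = k then 1 else 0) + z * green z j k"
proof -
  let ?p = "\<lambda>k x. poly (orth_poly a b k) x"
  have "jacobi_action a b (\<lambda>k. complex_of_real (?p j x * ?p k x) / (complex_of_real x - z)) k
      = complex_of_real (?p j x * ?p k x) + z * (complex_of_real (?p j x * ?p k x) / (complex_of_real x - z))"
    for x
  proof -
    have nz: "complex_of_real x - z \<noteq> 0"
      using z by (auto simp: complex_eq_iff)
    have "jacobi_action a b (\<lambda>k. complex_of_real (?p j x * ?p k x) / (complex_of_real x - z)) k
        = complex_of_real (?p j x) * complex_of_real (jacobi_action a b (\<lambda>k. ?p k x) k) / (complex_of_real x - z)"
      by (simp add: jacobi_action_def scaleR_conv_of_real add_divide_distrib distrib_left mult.left_commute)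
    also have "jacobi_action a b (\<lambda>k. ?p k x) k = x * ?p k x"
      by (rule orth_poly_recurrence)
    finally show ?thesis
      using nz by (simp add: field_simps)
  qed
  then have "jacobi_action a b (green z j) k
      = (\<integral>x. complex_of_real (?p j x * ?p k x)
          + z * (complex_of_real (?p j x * ?p k x) / (complex_of_real x - z)) \<partial>M)"
    unfolding green_def using jacobi_action_integral[where F = "\<lambda>k x. complex_of_real (?p j x * ?p k x)
        / (complex_of_real x - z)" and k = k, OF integrable_green[OF z]] by (simp only:)
  also have "\<dots> = complex_of_real (\<integral>x. ?p j x * ?p k x \<partial>M) + z * green z j k"
    unfolding green_def using integrable_orth[of j k] integrable_green[OF z, of j k]
    by (subst Bochner_Integration.integral_add) (simp_all del: of_real_mult times_divide_eq_right)
  finally show ?thesis by (simp add: orthonormal)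
qed

text \<open>
  For fixed \<open>k\<close>, the recurrence in \<open>j\<close> is homogeneous below \<open>k\<close>, and so is that of the polynomials;
  hence the two solutions are proportional up to and including \<open>j = k\<close>.
\<close>

lemma green_factorization:
  assumes z: "Im z \<noteq> 0" and "j \<le> k"
  shows "green z j k = poly (orth_cpoly a b j) z * green z 0 k"
proof (rule jacobi_action_unique[where n = k and z = z and f = "\<lambda>j. green z j k"
      and g = "\<lambda>j. poly (orth_cpoly a b j) z * green z 0 k"])
  show "jacobi_action a b (\<lambda>j. green z j k) i = z * green z i k" if "i < k" for i
    using green_recurrence[OF z, of k i] that by (simp add: green_sym[of z _ k])
  show "jacobi_action a b (\<lambda>j. poly (orth_cpoly a b j) z * green z 0 k) i
      = z * (poly (orth_cpoly a b i) z * green z 0 k)" for i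
  proof -
    have "jacobi_action a b (\<lambda>j. poly (orth_cpoly a b j) z * green z 0 k) i
        = jacobi_action a b (\<lambda>j. poly (orth_cpoly a b j) z) i * green z 0 k"
      by (simp add: jacobi_action_def distrib_right)
    then show ?thesis by (simp add: orth_cpoly_recurrence)
  qed
qed (use assms in simp_all)

lemma norm_green_diagonal:
  assumes z: "Im z \<noteq> 0"
  shows "cmod (green z k k) \<le> 1 / \<bar>Im z\<bar>"
proof -
  let ?g = "\<lambda>x. complex_of_real (poly (orth_poly a b k) x * poly (orth_poly a b k) x) / (complex_of_real x - z)"
  have "cmod (green z k k) \<le> (\<integral>x. cmod (?g x) \<partial>M)"
    unfolding green_def by (rule integral_norm_bound)
  also have "\<dots> \<le> (\<integral>x. poly (orth_poly a b k) x * poly (orth_poly a b k) x / \<bar>Im z\<bar> \<partial>M)"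
  proof (rule integral_mono)
    show "integrable M (\<lambda>x. cmod (?g x))"
      by (rule integrable_norm[OF integrable_green[OF z]])
    show "integrable M (\<lambda>x. poly (orth_poly a b k) x * poly (orth_poly a b k) x / \<bar>Im z\<bar>)"
      using integrable_orth by simp
    show "cmod (?g x) \<le> poly (orth_poly a b k) x * poly (orth_poly a b k) x / \<bar>Im z\<bar>" for x
      using norm_kernel_bound[OF z, of "poly (orth_poly a b k) x * poly (orth_poly a b k) x" x]
      by (simp del: of_real_mult)
  qed
  finally show ?thesis by (simp add: orthonormal)
qed

lemma cauchy_transform_kernel_density:
  assumes z: "Im z \<noteq> 0"
  shows "cauchy_transform
      (density M (\<lambda>x. ennreal (Re (jacobi_kernel a b n (complex_of_real x) (complex_of_real x))))) z
    = (\<Sum>k\<le>n. green z k k)"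
proof -
  let ?p = "\<lambda>k x. poly (orth_poly a b k) x"
  have K: "Re (jacobi_kernel a b n (complex_of_real x) (complex_of_real x)) = (\<Sum>k\<le>n. ?p k x * ?p k x)" for x
    by (simp add: jacobi_kernel_def jacobi_poly_eq_orth_cpoly orth_cpoly_of_real)
  have "cauchy_transform
      (density M (\<lambda>x. ennreal (Re (jacobi_kernel a b n (complex_of_real x) (complex_of_real x))))) z
    = (\<integral>x. (\<Sum>k\<le>n. ?p k x * ?p k x) *\<^sub>R (1 / (complex_of_real x - z)) \<partial>M)"
    unfolding cauchy_transform_def K by (rule integral_density) (auto intro!: sum_nonneg)
  also have "\<dots> = (\<integral>x. (\<Sum>k\<le>n. complex_of_real (?p k x * ?p k x) / (complex_of_real x - z)) \<partial>M)"
    by (simp add: scaleR_conv_of_real sum_divide_distrib)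
  also have "\<dots> = (\<Sum>k\<le>n. green z k k)"
    unfolding green_def by (rule Bochner_Integration.integral_sum) (rule integrable_green[OF z])
  finally show ?thesis .
qed

text \<open>
  Let \<open>d = p'\<close>. The Lagrange identity for \<open>(d, q)\<close> sums \<open>p\<^sub>k q\<^sub>k\<close>, for \<open>(p, q)\<close> it gives the constant
  Wronskian \<open>- 1\<close>, and for \<open>(d, p)\<close> it sums \<open>p\<^sub>k\<^sup>2\<close>. Multiplying \<open>d\<^sub>n\<^sub>+\<^sub>1\<close> by the Wronskian makes the
  terms with \<open>q\<^sub>n\<close> cancel.
\<close>

lemma trace_difference:
  assumes z: "Im z \<noteq> 0"
  shows "- poly (pderiv (orth_cpoly a b (Suc n))) z / poly (orth_cpoly a b (Suc n)) z - (\<Sum>k\<le>n. green z k k)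
    = - (green z 0 (Suc n) / poly (orth_cpoly a b (Suc n)) z) * (\<Sum>k\<le>n. (poly (orth_cpoly a b k) z)\<^sup>2)"
proof -
  define p d q where "p k = poly (orth_cpoly a b k) z" and "d k = poly (pderiv (orth_cpoly a b k)) z"
    and "q k = green z 0 k" for k
  have p: "jacobi_action a b p k = z * p k" for k
    unfolding p_def[abs_def] by (rule orth_cpoly_recurrence)
  have d: "jacobi_action a b d k = z * d k + p k" for k
    unfolding p_def d_def[abs_def] by (rule orth_cpoly_pderiv_recurrence)
  have q: "jacobi_action a b q k = (if k = 0 then 1 else 0) + z * q k" for k
    using green_recurrence[OF z, of 0 k] by (cases "k = 0") (simp_all add: q_def[abs_def])
  have p0: "p 0 = 1" "d 0 = 0"
    by (simp_all add: p_def d_def)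
  have nz: "p (Suc n) \<noteq> 0"
    unfolding p_def by (rule orth_cpoly_nonzero[OF z])
  have "(\<Sum>k\<le>n. green z k k) = (\<Sum>k\<le>n. p k * q k)"
    unfolding p_def q_def by (intro sum.cong green_factorization[OF z]) auto
  also have "\<dots> = (\<Sum>k\<le>n. jacobi_action a b d k * q k - d k * jacobi_action a b q k)"
    by (intro sum.cong) (auto simp: d q p0 algebra_simps)
  finally have dq: "(\<Sum>k\<le>n. green z k k) = a n *\<^sub>R (d (Suc n) * q n - d n * q (Suc n))"
    by (simp add: lagrange_identity)
  have "(\<Sum>k\<le>n. if k = 0 then - 1 else 0) = (\<Sum>k\<le>n. jacobi_action a b p k * q k - p k * jacobi_action a b q k)"
    by (intro sum.cong) (auto simp: p q p0 algebra_simps)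
  then have pq: "a n *\<^sub>R (p (Suc n) * q n - p n * q (Suc n)) = - 1"
    by (simp add: lagrange_identity)
  have pp: "(\<Sum>k\<le>n. (p k)\<^sup>2) = a n *\<^sub>R (d (Suc n) * p n - d n * p (Suc n))"
    unfolding p_def d_def by (rule christoffel_darboux_confluent)
  have "- d (Suc n) - (\<Sum>k\<le>n. green z k k) * p (Suc n) = - q (Suc n) * (\<Sum>k\<le>n. (p k)\<^sup>2)"
  proof -
    have "- d (Suc n) = d (Suc n) * (a n *\<^sub>R (p (Suc n) * q n - p n * q (Suc n)))"
      by (simp add: pq)
    then show ?thesis
      unfolding dq pp by (simp add: algebra_simps)
  qed
  then show ?thesis
    using nz by (simp add: p_def[symmetric] d_def[symmetric] q_def[symmetric] field_simps)
qed

text \<open>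
  Bessel's inequality in \<open>L\<^sup>2(M)\<close> for the function \<open>p\<^sub>m(x) / (x - z)\<close>, whose coefficients are
  \<open>green z m j\<close>. Its squared norm is the right-hand side since \<open>Im (1 / (x - z)) = Im z / \<bar>x - z\<bar>\<^sup>2\<close>.
\<close>

lemma bessel_green:
  assumes z: "Im z \<noteq> 0"
  shows "(\<Sum>j\<le>n. (cmod (green z m j))\<^sup>2) \<le> Im (green z m m) / Im z"
proof -
  let ?p = "\<lambda>k x. poly (orth_poly a b k) x"
  let ?G = "\<lambda>j k x. complex_of_real (?p j x * ?p k x) / (complex_of_real x - z)"
  define c where "c j = green z m j" for j
  have square: "(cmod (complex_of_real (?p m x) / (complex_of_real x - z)))\<^sup>2 = Im (?G m m x) / Im z" for x
  proof -
    have "?G m m x = complex_of_real (?p m x * ?p m x) * cnj (complex_of_real x - z)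
        / complex_of_real ((cmod (complex_of_real x - z))\<^sup>2)"
      by (subst complex_div_cnj) simp
    then have "Im (?G m m x) = ?p m x * ?p m x * Im z / (cmod (complex_of_real x - z))\<^sup>2"
      by (simp only: Im_divide_of_real) simp
    then show ?thesis
      using z by (simp add: norm_divide power_divide power2_eq_square)
  qed
  \<comment> \<open>The square of the distance to the projection onto the span of \<open>p\<^sub>0, \<dots>, p\<^sub>n\<close>, expanded so
    that each summand can be integrated.\<close>
  have expand: "(cmod (complex_of_real (?p m x) / (complex_of_real x - z) - (\<Sum>j\<le>n. c j * complex_of_real (?p j x))))\<^sup>2
      = Im (?G m m x) / Im z - 2 * Re (\<Sum>j\<le>n. cnj (c j) * ?G m j x)
        + (\<Sum>i\<le>n. \<Sum>j\<le>n. Re (c i * cnj (c j)) * (?p i x * ?p j x))" for x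
  proof -
    define u where "u = complex_of_real (?p m x) / (complex_of_real x - z)"
    define v where "v = (\<Sum>j\<le>n. c j * complex_of_real (?p j x))"
    have "(cmod (u - v))\<^sup>2 = (cmod u)\<^sup>2 - 2 * Re (u * cnj v) + Re (v * cnj v)"
      by (simp only: cmod_power2) (simp add: power2_eq_square algebra_simps)
    moreover have "u * cnj v = (\<Sum>j\<le>n. cnj (c j) * ?G m j x)"
      by (simp add: u_def v_def sum_distrib_left mult_ac)
    moreover have "v * cnj v = (\<Sum>i\<le>n. \<Sum>j\<le>n. c i * cnj (c j) * complex_of_real (?p i x * ?p j x))"
      by (simp add: v_def sum_product mult_ac)
    moreover have "Re (\<Sum>i\<le>n. \<Sum>j\<le>n. c i * cnj (c j) * complex_of_real (?p i x * ?p j x))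
        = (\<Sum>i\<le>n. \<Sum>j\<le>n. Re (c i * cnj (c j)) * (?p i x * ?p j x))"
      by (simp only: Re_sum Re_complex_of_real Im_complex_of_real times_complex.sel) simp
    ultimately show ?thesis
      using square[of x] by (simp only: u_def v_def)
  qed
  have int: "integrable M (\<lambda>x. Im (?G m m x) / Im z)"
    "integrable M (\<lambda>x. \<Sum>j\<le>n. cnj (c j) * ?G m j x)"
    "integrable M (\<lambda>x. \<Sum>i\<le>n. \<Sum>j\<le>n. Re (c i * cnj (c j)) * (?p i x * ?p j x))"
    using integrable_green[OF z] integrable_orth
    by (auto intro!: Bochner_Integration.integrable_sum integrable_mult_right integrable_divide
        simp del: of_real_mult times_divide_eq_right)
  have int_square: "(\<integral>x. Im (?G m m x) / Im z \<partial>M) = Im (green z m m) / Im z"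
    unfolding green_def using integrable_green[OF z, of m m] by (simp del: of_real_mult)
  have int_cross: "(\<integral>x. Re (\<Sum>j\<le>n. cnj (c j) * ?G m j x) \<partial>M) = (\<Sum>j\<le>n. (cmod (c j))\<^sup>2)"
  proof -
    have "(\<integral>x. Re (\<Sum>j\<le>n. cnj (c j) * ?G m j x) \<partial>M) = Re (\<integral>x. (\<Sum>j\<le>n. cnj (c j) * ?G m j x) \<partial>M)"
      using int(2) by (rule integral_Re)
    also have "(\<integral>x. (\<Sum>j\<le>n. cnj (c j) * ?G m j x) \<partial>M) = (\<Sum>j\<le>n. cnj (c j) * c j)"
      unfolding c_def green_def using integrable_green[OF z]
      by (subst Bochner_Integration.integral_sum) (simp_all del: of_real_mult times_divide_eq_right)
    also have "Re \<dots> = (\<Sum>j\<le>n. (cmod (c j))\<^sup>2)"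
      by (simp add: cmod_power2 sum.distrib flip: power2_eq_square)
    finally show ?thesis .
  qed
  have int_sum: "(\<integral>x. (\<Sum>i\<le>n. \<Sum>j\<le>n. Re (c i * cnj (c j)) * (?p i x * ?p j x)) \<partial>M) = (\<Sum>j\<le>n. (cmod (c j))\<^sup>2)"
  proof -
    have "(\<integral>x. (\<Sum>i\<le>n. \<Sum>j\<le>n. Re (c i * cnj (c j)) * (?p i x * ?p j x)) \<partial>M)
        = (\<Sum>i\<le>n. \<Sum>j\<le>n. Re (c i * cnj (c j)) * (if i = j then 1 else 0))"
      using integrable_orth
      by (subst Bochner_Integration.integral_sum, simp)
        (subst Bochner_Integration.integral_sum, simp, simp only: integral_mult_right_zero orthonormal)
    also have "\<dots> = (\<Sum>i\<le>n. (cmod (c i))\<^sup>2)"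
      by (intro sum.cong) (simp_all add: mult_delta_right cmod_power2 flip: power2_eq_square)
    finally show ?thesis .
  qed
  have "0 \<le> (\<integral>x. (cmod (complex_of_real (?p m x) / (complex_of_real x - z)
      - (\<Sum>j\<le>n. c j * complex_of_real (?p j x))))\<^sup>2 \<partial>M)"
    by (rule integral_nonneg_AE) simp
  also have "\<dots> = Im (green z m m) / Im z - 2 * (\<Sum>j\<le>n. (cmod (c j))\<^sup>2) + (\<Sum>j\<le>n. (cmod (c j))\<^sup>2)"
    unfolding expand int_square[symmetric] using int(1,3) integrable_Re[OF int(2)]
    by (subst int_sum[symmetric], subst int_cross[symmetric]) 
      (simp only: Bochner_Integration.integral_add Bochner_Integration.integral_diff
        integral_mult_right_zero Bochner_Integration.integrable_diff integrable_mult_right)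
  finally show ?thesis by (simp add: c_def)
qed

text \<open>
  Both sides of Bessel's inequality for \<open>m = n + 1\<close> contain the factor \<open>q = green z 0 (n + 1)\<close>, squared
  on the left and simple on the right; cancelling it leaves a bound for precisely the quotient that
  occurs in \<open>trace_difference\<close>.
\<close>

theorem cauchy_transform_nu_eta_bound:
  assumes z: "Im z \<noteq> 0"
  shows "cmod (cauchy_transform (nu_measure a b n) z - (\<Sum>k\<le>n. green z k k)) \<le> 1 / \<bar>Im z\<bar>"
proof -
  define p where "p k = poly (orth_cpoly a b k) z" for k
  define q where "q = green z 0 (Suc n)"
  define S where "S = (\<Sum>k\<le>n. (cmod (p k))\<^sup>2)"
  have nz: "p (Suc n) \<noteq> 0"
    unfolding p_def by (rule orth_cpoly_nonzero[OF z])
  have G: "green z (Suc n) j = p j * q" if "j \<le> Suc n" for j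
    using green_factorization[OF z that] green_sym[of z "Suc n" j] by (simp add: p_def q_def)
  have "(cmod q)\<^sup>2 * S = (\<Sum>j\<le>n. (cmod (green z (Suc n) j))\<^sup>2)"
    unfolding S_def sum_distrib_left
    by (intro sum.cong) (auto simp: G norm_mult power_mult_distrib)
  also have "\<dots> \<le> Im (green z (Suc n) (Suc n)) / Im z"
    by (rule bessel_green[OF z])
  also have "\<dots> \<le> \<bar>Im (green z (Suc n) (Suc n)) / Im z\<bar>"
    by (rule abs_ge_self)
  also have "\<dots> \<le> cmod (green z (Suc n) (Suc n)) / \<bar>Im z\<bar>"
    unfolding abs_divide by (intro divide_right_mono abs_Im_le_cmod) simp
  finally have bound: "cmod q * (cmod q * S) \<le> cmod q * (cmod (p (Suc n)) / \<bar>Im z\<bar>)"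
    by (simp add: G norm_mult power2_eq_square mult_ac)
  have "cauchy_transform (nu_measure a b n) z - (\<Sum>k\<le>n. green z k k)
      = - (q / p (Suc n)) * (\<Sum>k\<le>n. (p k)\<^sup>2)"
    using trace_difference[OF z, of n] by (simp add: cauchy_transform_nu[OF z] p_def q_def)
  then have "cmod (cauchy_transform (nu_measure a b n) z - (\<Sum>k\<le>n. green z k k))
      = cmod q / cmod (p (Suc n)) * cmod (\<Sum>k\<le>n. (p k)\<^sup>2)"
    by (simp add: norm_mult norm_divide)
  also have "\<dots> \<le> cmod q / cmod (p (Suc n)) * S"
  proof (rule mult_left_mono)
    show "cmod (\<Sum>k\<le>n. (p k)\<^sup>2) \<le> S"
      unfolding S_def by (rule order_trans[OF norm_sum]) (simp add: norm_power)
  qed simp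
  also have "\<dots> \<le> 1 / \<bar>Im z\<bar>"
  proof (cases "q = 0")
    case False
    then have "cmod q * S \<le> cmod (p (Suc n)) / \<bar>Im z\<bar>"
      using bound by (subst (asm) mult_le_cancel_left_pos) simp_all
    then show ?thesis
      using nz z by (simp add: divide_simps mult.commute split: if_splits)
  qed simp
  finally show ?thesis .
qed

end

section \<open>Additivity of integrals in the measure\<close>

text \<open>
  Here \<open>M\<close> is the sum of \<open>N1\<close> and \<open>N2\<close>, expressed by its values on sets; the usual induction over
  measurable functions carries this over to integrals.
\<close>

lemma nn_integral_emeasure_add:
  assumes sets [measurable_cong]: "sets N1 = sets M" "sets N2 = sets M"
    and add: "\<And>S. S \<in> sets M \<Longrightarrow> emeasure M S = emeasure N1 S + emeasure N2 S"
    and "f \<in> borel_measurable M"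
  shows "nn_integral M f = nn_integral N1 f + nn_integral N2 f"
  using assms(4)
proof (induction rule: borel_measurable_induct)
  case (cong f g)
  have "space N1 = space M" "space N2 = space M"
    using sets sets_eq_imp_space_eq by blast+
  with cong show ?case
    by (metis nn_integral_cong)
next
  case (set S)
  then show ?case
    by (simp add: add sets)
next
  case (mult u c)
  then show ?case
    by (simp add: nn_integral_cmult distrib_left)
next
  case (add u v)
  then show ?case
    by (simp add: nn_integral_add algebra_simps)
next
  case (seq U)
  then have "incseq (\<lambda>i. nn_integral N1 (U i))" "incseq (\<lambda>i. nn_integral N2 (U i))"
    by (auto simp: incseq_def le_fun_def intro!: nn_integral_mono)
  moreover have "nn_integral M (SUP i. U i) = (SUP i. nn_integral M (U i))"
    "nn_integral N1 (SUP i. U i) = (SUP i. nn_integral N1 (U i))"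
    "nn_integral N2 (SUP i. U i) = (SUP i. nn_integral N2 (U i))"
    using seq by (simp_all add: nn_integral_monotone_convergence_SUP SUP_apply[abs_def]
        image_comp cong: measurable_cong_sets)
  ultimately show ?case
    using seq by (simp only: ennreal_SUP_add)
qed

lemma integral_emeasure_add:
  fixes f :: "'a \<Rightarrow> real"
  assumes sets [measurable_cong]: "sets N1 = sets M" "sets N2 = sets M"
    and add: "\<And>S. S \<in> sets M \<Longrightarrow> emeasure M S = emeasure N1 S + emeasure N2 S"
    and int: "integrable N1 f" "integrable N2 f"
  shows "integral\<^sup>L M f = integral\<^sup>L N1 f + integral\<^sup>L N2 f"
proof -
  have f[measurable]: "f \<in> borel_measurable M"
    using int(1) sets(1) by (simp add: integrable_iff_bounded cong: measurable_cong_sets)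
  have *: "nn_integral M (\<lambda>x. ennreal (g x)) = nn_integral N1 (\<lambda>x. ennreal (g x))
      + nn_integral N2 (\<lambda>x. ennreal (g x))"
    if [measurable]: "g \<in> borel_measurable M" for g :: "'a \<Rightarrow> real"
    by (rule nn_integral_emeasure_add[OF sets add]) auto
  have "integrable M f"
    using int *[of "\<lambda>x. norm (f x)"] by (auto simp: integrable_iff_bounded)
  then show ?thesis
    using int *[of f] *[of "\<lambda>x. - f x"]
    by (simp add: real_lebesgue_integral_def real_integrable_def enn2real_plus less_top)
qed

section \<open>Spectral families and the measures they induce\<close>

text \<open>
  A projection-valued measure on a real inner product space. On the complex sequence space the inner
  product is the real part of the complex one; the diagonal values \<open>\<langle>E S x, x\<rangle>\<close>, from which the measures
  are made, are the same for both.
\<close>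

locale spectral_family =
  fixes E :: "real set \<Rightarrow> 'h \<Rightarrow> 'h :: real_inner"
  assumes E_add: "S \<in> sets borel \<Longrightarrow> E S (x + y) = E S x + E S y"
    and E_scaleR: "S \<in> sets borel \<Longrightarrow> E S (r *\<^sub>R x) = r *\<^sub>R E S x"
    and E_sa: "S \<in> sets borel \<Longrightarrow> inner (E S x) y = inner x (E S y)"
    and E_empty: "E {} x = 0"
    and E_UNIV: "E UNIV x = x"
    and E_Int: "S \<in> sets borel \<Longrightarrow> R \<in> sets borel \<Longrightarrow> E (S \<inter> R) x = E S (E R x)"
    and E_sums: "range F \<subseteq> sets borel \<Longrightarrow> disjoint_family F
      \<Longrightarrow> (\<lambda>k. E (F k) x) sums E (\<Union>k::nat. F k) x"
begin

definition mu :: "'h \<Rightarrow> real measure" where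
  "mu x = measure_of UNIV (sets borel) (\<lambda>S. ennreal (inner (E S x) x))"

lemma sets_mu [simp, measurable_cong]: "sets (mu x) = sets borel"
  unfolding mu_def using sets.sigma_sets_eq[of borel] by (simp add: sets_measure_of)

lemma space_mu [simp]: "space (mu x) = UNIV"
  using sets_eq_imp_space_eq[OF sets_mu] by simp

lemma E_idem: "S \<in> sets borel \<Longrightarrow> E S (E S x) = E S x"
  using E_Int[of S S x] by simp

lemma inner_E_self: "S \<in> sets borel \<Longrightarrow> inner (E S x) x = (norm (E S x))\<^sup>2"
  using E_sa[of S "E S x" x] by (simp add: E_idem power2_norm_eq_inner)

lemma emeasure_mu:
  assumes "S \<in> sets borel"
  shows "emeasure (mu x) S = ennreal (inner (E S x) x)"
  unfolding mu_def
proof (rule emeasure_measure_of_sigma)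
  show "sigma_algebra UNIV (sets (borel :: real measure))"
    using sets.sigma_algebra_axioms[of "borel :: real measure"] by simp
  show "positive (sets borel) (\<lambda>S. ennreal (inner (E S x) x))"
    by (simp add: positive_def E_empty)
  show "countably_additive (sets borel) (\<lambda>S. ennreal (inner (E S x) x))"
    unfolding countably_additive_def
  proof (intro allI impI)
    fix F :: "nat \<Rightarrow> real set"
    assume F: "range F \<subseteq> sets borel" "disjoint_family F"
    have "(\<lambda>k. inner (E (F k) x) x) sums inner (E (\<Union>k. F k) x) x"
      using bounded_linear.sums[OF bounded_linear_inner_left E_sums[OF F]] .
    moreover have "0 \<le> inner (E (F k) x) x" for k
      using F(1) by (simp add: inner_E_self range_subsetD)
    ultimately show "(\<Sum>k. ennreal (inner (E (F k) x) x)) = ennreal (inner (E (\<Union>(range F)) x) x)"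
      by (intro suminf_ennreal_eq)
  qed
qed (use assms in auto)

lemma emeasure_mu_norm: "S \<in> sets borel \<Longrightarrow> emeasure (mu x) S = ennreal ((norm (E S x))\<^sup>2)"
  by (simp add: emeasure_mu inner_E_self)

lemma finite_measure_mu: "finite_measure (mu x)"
  by (rule finite_measureI) (simp add: emeasure_mu)

lemma integrable_mu_bounded:
  fixes f :: "real \<Rightarrow> real"
  assumes [measurable]: "f \<in> borel_measurable borel" and "AE t in mu x. \<bar>f t\<bar> \<le> B"
  shows "integrable (mu x) f"
proof -
  interpret finite_measure "mu x" by (rule finite_measure_mu)
  show ?thesis using assms(2) by (intro integrable_const_bound[where B = B]) auto
qed

lemma integrable_id_of_square:
  assumes "integrable (mu x) (\<lambda>t. t\<^sup>2)"
  shows "integrable (mu x) (\<lambda>t. t)"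
proof -
  interpret finite_measure "mu x" by (rule finite_measure_mu)
  show ?thesis
    by (rule square_integrable_imp_integrable) (use assms in auto)
qed

lemma mu_E:
  assumes "S \<in> sets borel"
  shows "mu (E S x) = density (mu x) (indicator S)"
proof (rule measure_eqI)
  fix R assume R: "R \<in> sets (mu (E S x))"
  then have "emeasure (mu (E S x)) R = emeasure (mu x) (S \<inter> R)"
    using assms by (simp add: emeasure_mu_norm E_Int[symmetric] Int_commute)
  then show "emeasure (mu (E S x)) R = emeasure (density (mu x) (indicator S)) R"
    using assms R by (simp add: emeasure_density indicator_inter_arith[symmetric])
qed simp

lemma integral_mu_E:
  fixes f :: "real \<Rightarrow> real"
  assumes [measurable]: "S \<in> sets borel" "f \<in> borel_measurable borel"
  shows "integral\<^sup>L (mu (E S x)) f = (\<integral>t. indicator S t * f t \<partial>mu x)"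
proof -
  have "mu (E S x) = density (mu x) (\<lambda>t. ennreal (indicator S t))"
    by (simp add: mu_E ennreal_indicator)
  then show ?thesis by (simp add: integral_density)
qed

lemma integrable_mu_E:
  fixes f :: "real \<Rightarrow> real"
  assumes [measurable]: "S \<in> sets borel" "f \<in> borel_measurable borel"
  shows "integrable (mu (E S x)) f \<longleftrightarrow> integrable (mu x) (\<lambda>t. indicator S t * f t)"
proof -
  have "mu (E S x) = density (mu x) (\<lambda>t. ennreal (indicator S t))"
    by (simp add: mu_E ennreal_indicator)
  then show ?thesis by (simp add: integrable_density)
qed

lemma E_split: "S \<in> sets borel \<Longrightarrow> x = E S x + E (- S) x"
proof -
  assume S: "S \<in> sets borel"
  \<comment> \<open>Countable additivity applied to the sequence \<open>S, - S, {}, {}, \<dots>\<close>.\<close>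
  define F where "F k = (if k = 0 then S else if k = 1 then - S else {})" for k :: nat
  have "(\<lambda>k. E (F k) x) sums E (\<Union>k. F k) x"
    by (rule E_sums) (use S in \<open>auto simp: F_def disjoint_family_on_def\<close>)
  moreover have "(\<Union>k. F k) = UNIV"
  proof -
    have "F 0 \<union> F 1 = UNIV" by (simp add: F_def)
    then show ?thesis by blast
  qed
  moreover have "(\<lambda>k. E (F k) x) sums (\<Sum>k\<in>{0, 1}. E (F k) x)"
    by (rule sums_finite) (auto simp: F_def E_empty)
  ultimately have "E UNIV x = (\<Sum>k\<in>{0, 1}. E (F k) x)"
    by (metis sums_unique2)
  then show ?thesis by (simp add: E_UNIV F_def)
qed

lemma AE_mu_fixed:
  assumes "S \<in> sets borel" "E S x = x"
  shows "AE t in mu x. t \<in> S"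
proof -
  have "E (- S) x = 0"
    using E_split[OF assms(1), of x] assms(2) by simp
  then have "emeasure (mu x) (- S) = 0"
    using assms by (simp add: emeasure_mu)
  then show ?thesis
    using assms(1) by (intro AE_I[where N = "- S"]) auto
qed

end

section \<open>The spectral measure of an image vector\<close>

text \<open>
  A symmetric densely defined operator, given by its graph \<open>T\<close>, whose domain and quadratic form are the
  ones prescribed by \<open>E\<close>.
\<close>

locale spectral_resolution = spectral_family E
  for E :: "real set \<Rightarrow> 'h \<Rightarrow> 'h :: real_inner" +
  fixes T :: "('h \<times> 'h) set"
  assumes T_add: "(x, y) \<in> T \<Longrightarrow> (u, v) \<in> T \<Longrightarrow> (x + u, y + v) \<in> T"
    and T_scaleR: "(x, y) \<in> T \<Longrightarrow> (r *\<^sub>R x, r *\<^sub>R y) \<in> T"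
    and T_single: "(x, y) \<in> T \<Longrightarrow> (x, y') \<in> T \<Longrightarrow> y = y'"
    and T_sym: "(x, y) \<in> T \<Longrightarrow> (u, v) \<in> T \<Longrightarrow> inner y u = inner x v"
    and T_dense: "closure (Domain T) = UNIV"
    and T_Domain: "Domain T = {x. integrable (mu x) (\<lambda>t. t\<^sup>2)}"
    and T_form: "(x, y) \<in> T \<Longrightarrow> inner y x = (\<integral>t. t \<partial>mu x)"
begin

lemma integrable_square: "(x, y) \<in> T \<Longrightarrow> integrable (mu x) (\<lambda>t. t\<^sup>2)"
  using T_Domain by (metis DomainI mem_Collect_eq)

lemma integrable_id: "(x, y) \<in> T \<Longrightarrow> integrable (mu x) (\<lambda>t. t)"
  by (rule integrable_id_of_square[OF integrable_square])

lemma E_Domain: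
  assumes "S \<in> sets borel" "x \<in> Domain T"
  shows "E S x \<in> Domain T"
  using assms integrable_real_mult_indicator[of S "mu x" "\<lambda>t. t\<^sup>2"]
  by (simp add: T_Domain integrable_mu_E mult.commute[of "indicator S _"])

lemma E_Domain_bounded:
  assumes "S \<in> sets borel" "\<And>t. t \<in> S \<Longrightarrow> \<bar>t\<bar> \<le> B"
  shows "E S x \<in> Domain T"
proof -
  have "\<bar>indicator S t * t\<^sup>2\<bar> \<le> B\<^sup>2" for t
    using assms(2)[of t] by (cases "t \<in> S") (auto simp: abs_le_square_iff[symmetric])
  then show ?thesis
    using assms by (simp add: T_Domain integrable_mu_E integrable_mu_bounded[where B = "B\<^sup>2"])
qed

lemma orthogonal_Domain_imp_zero:
  assumes "\<And>u. u \<in> Domain T \<Longrightarrow> inner x u = 0"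
  shows "x = 0"
proof -
  have "closed {u. inner x u = 0}"
    by (intro closed_Collect_eq continuous_intros)
  then have "closure (Domain T) \<subseteq> {u. inner x u = 0}"
    using assms by (intro closure_minimal) auto
  then have "inner x x = 0"
    unfolding T_dense by blast
  then show ?thesis by simp
qed

text \<open>
  The spectral measure of \<open>x + u\<close> is the sum of those of \<open>x\<close> and \<open>u\<close>, since the two vectors live on
  disjoint spectral sets. So the quadratic form has no mixed term; by symmetry of \<open>T\<close> the mixed term is
  twice \<open>inner y u\<close>.
\<close>

lemma form_orthogonal:
  assumes S: "S \<in> sets borel"
    and xy: "(x, y) \<in> T" "E S x = x" and uv: "(u, v) \<in> T" "E (- S) u = u"
  shows "inner y u = 0"
proof -
  have S': "- S \<in> sets borel" using S by auto
  have "emeasure (mu (x + u)) R = emeasure (mu x) R + emeasure (mu u) R"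
    if R: "R \<in> sets (mu (x + u))" for R
  proof -
    have R: "R \<in> sets borel" using R by simp
    have "inner (E R x) u = inner (E R (E S x)) (E (- S) u)"
      using xy uv by simp
    also have "E R (E S x) = E S (E R x)"
      using R S by (simp add: E_Int[symmetric] Int_commute)
    also have "inner (E S (E R x)) (E (- S) u) = inner (E R x) (E (S \<inter> - S) u)"
      using S S' by (simp only: E_sa E_Int)
    finally have "inner (E R x) u = 0" by (simp add: E_empty)
    moreover from this have "inner (E R u) x = 0"
      using R by (metis E_sa inner_commute)
    ultimately show ?thesis
      using R by (simp add: emeasure_mu E_add inner_add_left inner_add_right inner_E_self
          flip: ennreal_plus)
  qed
  then have "(\<integral>t. t \<partial>mu (x + u)) = (\<integral>t. t \<partial>mu x) + (\<integral>t. t \<partial>mu u)"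
    using integrable_id xy uv by (intro integral_emeasure_add) auto
  then have "inner (y + v) (x + u) = inner y x + inner v u"
    using T_form T_add xy uv by simp
  then have "inner y u + inner v x = 0"
    by (simp add: inner_add_left inner_add_right)
  moreover have "inner v x = inner y u"
    using T_sym xy uv by (simp add: inner_commute)
  ultimately show ?thesis by simp
qed

text \<open>
  The orthogonality of \<open>form_orthogonal\<close> is available only against vectors of the domain, which is enough
  because the domain is dense and \<open>E (- S)\<close> maps it into itself.
\<close>

lemma E_preserves_range:
  assumes S: "S \<in> sets borel" and xy: "(x, y) \<in> T" "E S x = x"
  shows "E (- S) y = 0"
proof (rule orthogonal_Domain_imp_zero)
  fix u assume "u \<in> Domain T"
  then obtain v where "(E (- S) u, v) \<in> T"
    using E_Domain[of "- S" u] S by auto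
  then have "inner y (E (- S) u) = 0"
    using form_orthogonal[OF S xy] S by (simp add: E_idem)
  then show "inner (E (- S) y) u = 0" using S by (simp add: E_sa)
qed

text \<open>
  By \<open>E_preserves_range\<close>, the operator maps each of the two parts of \<open>x\<close> into the range of the same
  projection, so applying \<open>E S\<close> to the image of the sum keeps just the image of the first part.
\<close>

lemma E_commute:
  assumes S: "S \<in> sets borel" and xy: "(x, y) \<in> T"
  shows "(E S x, E S y) \<in> T"
proof -
  have S': "- S \<in> sets borel" using S by auto
  \<comment> \<open>Images of the two parts of \<open>x\<close> exist since \<open>E S\<close> and \<open>E (- S)\<close> preserve the domain.\<close>
  obtain y1 y2 where y1: "(E S x, y1) \<in> T" and y2: "(E (- S) x, y2) \<in> T"
    using E_Domain[OF S] E_Domain[OF S'] xy by blast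
  have "y = y1 + y2"
    using T_single[OF xy] T_add[OF y1 y2] E_split[OF S, of x] by simp
  moreover have "E S y1 = y1"
    using E_preserves_range[OF S y1] E_split[OF S, of y1] S by (simp add: E_idem)
  moreover have "E S y2 = 0"
    using E_preserves_range[OF S' y2] S' by (simp add: E_idem)
  ultimately show ?thesis
    using y1 S by (simp add: E_add)
qed

text \<open>
  The norm of \<open>v = T u\<close> is obtained from the quadratic form by polarization: expand the form at
  \<open>u + \<sigma> T u\<close>. Its spectral measure is \<open>(1 + 2 \<bar>t\<bar>) \<mu>\<^sub>u + \<mu>\<^sub>v\<close>, and comparing the mixed terms on both sides
  gives \<open>\<parallel>v\<parallel>\<^sup>2 = \<integral> t\<^sup>2 d\<mu>\<^sub>u\<close>. Boundedness of \<open>S\<close> puts \<open>v\<close> back into the domain. The sign condition,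
  with \<open>\<sigma> = 1\<close> or \<open>\<sigma> = - 1\<close>, makes the mixed term a positive measure, so that signed measures do not
  occur.
\<close>

lemma norm_square_bounded:
  assumes S: "S \<in> sets borel" and bdd: "\<And>t. t \<in> S \<Longrightarrow> \<bar>t\<bar> \<le> B"
    and sgn: "\<And>t. t \<in> S \<Longrightarrow> \<bar>t\<bar> = \<sigma> * t" and \<sigma>: "\<sigma> * \<sigma> = 1"
    and uv: "(u, v) \<in> T" and u: "E S u = u"
  shows "(norm v)\<^sup>2 = (\<integral>t. t\<^sup>2 \<partial>mu u)"
proof -
  have \<sigma>\<sigma>: "\<sigma> * (\<sigma> * r) = r" for r
    using \<sigma> by (simp flip: mult.assoc)
  have AE: "AE t in mu u. t \<in> S"
    by (rule AE_mu_fixed[OF S u])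
  have "E S v = v"
    using T_single[OF uv, of "E S v"] E_commute[OF S uv] u by simp
  then obtain w where vw: "(v, w) \<in> T"
    using E_Domain_bounded[OF S bdd, of v] by (auto simp only: Domain_iff)
  have int: "integrable (mu u) (\<lambda>t. t)" "integrable (mu u) (\<lambda>t. t\<^sup>2)"
    "integrable (mu v) (\<lambda>t. t)"
    using integrable_id integrable_square uv vw by auto
  \<comment> \<open>The part \<open>(1 + 2 \<bar>t\<bar>) \<mu>\<^sub>u\<close> of the measure of \<open>u + \<sigma> T u\<close>.\<close>
  define N where "N = density (mu u) (\<lambda>t. ennreal (1 + 2 * \<bar>t\<bar>))"
  have "AE t in mu u. \<bar>(1 + 2 * \<bar>t\<bar>) * t\<bar> \<le> (1 + 2 * B) * B"
    using AE by eventually_elim (auto simp: abs_mult intro!: mult_mono dest: bdd)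
  then have intN: "integrable N (\<lambda>t. t)"
    unfolding N_def
    by (subst integrable_density) (auto intro: integrable_mu_bounded)
  have "(\<integral>t. t \<partial>N) = (\<integral>t. (1 + 2 * \<bar>t\<bar>) * t \<partial>mu u)"
    unfolding N_def by (subst integral_density) auto
  also have "\<dots> = (\<integral>t. t + 2 * \<sigma> * t\<^sup>2 \<partial>mu u)"
    using AE by (intro integral_cong_AE)
      (auto elim!: eventually_mono simp: sgn power2_eq_square algebra_simps)
  finally have N: "(\<integral>t. t \<partial>N) = inner v u + 2 * \<sigma> * (\<integral>t. t\<^sup>2 \<partial>mu u)"
    using int T_form[OF uv] by simp
  have "emeasure (mu (u + \<sigma> *\<^sub>R v)) R = emeasure N R + emeasure (mu v) R"
    if R: "R \<in> sets (mu (u + \<sigma> *\<^sub>R v))" for R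
  proof -
    have R[measurable]: "R \<in> sets borel" using R by simp
    have intR: "integrable (mu u) (\<lambda>t. indicator R t * t)"
      "integrable (mu u) (\<lambda>t. indicator R t :: real)"
      using integrable_real_mult_indicator[OF _ int(1), of R]
        integrable_mu_bounded[where f = "indicator R" and x = u and B = 1]
      by (simp_all add: mult.commute[of "indicator R _"])
    have "inner (E R v) (E R u) = (\<integral>t. indicator R t * t \<partial>mu u)"
      using T_form[OF E_commute[OF R uv]] R by (simp add: integral_mu_E)
    then have cross: "inner (E R v) u = (\<integral>t. indicator R t * t \<partial>mu u)"
      using R by (metis E_idem E_sa)
    have pos: "AE t in mu u. 0 \<le> indicator R t * (1 + 2 * \<sigma> * t)"
      using AE
    proof eventually_elim
      case (elim t)
      then have "0 \<le> \<sigma> * t" by (metis sgn abs_ge_zero)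
      then show ?case by (simp add: mult.assoc)
    qed
    have expand: "indicator R t * (1 + 2 * \<sigma> * t) = indicator R t + 2 * \<sigma> * (indicator R t * t)" for t
      by (simp add: distrib_left)
    have "emeasure N R = (\<integral>\<^sup>+t. ennreal (indicator R t * (1 + 2 * \<bar>t\<bar>)) \<partial>mu u)"
      unfolding N_def by (subst emeasure_density)
        (auto intro!: nn_integral_cong split: split_indicator)
    also have "\<dots> = (\<integral>\<^sup>+t. ennreal (indicator R t * (1 + 2 * \<sigma> * t)) \<partial>mu u)"
      using AE by (intro nn_integral_cong_AE) (auto elim!: eventually_mono simp: sgn mult.assoc)
    also have "\<dots> = ennreal (\<integral>t. indicator R t * (1 + 2 * \<sigma> * t) \<partial>mu u)"
      by (rule nn_integral_eq_integral[OF _ pos]) (simp add: expand intR)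
    finally have NR: "emeasure N R = ennreal (\<integral>t. indicator R t * (1 + 2 * \<sigma> * t) \<partial>mu u)" .
    have "(\<integral>t. indicator R t * (1 + 2 * \<sigma> * t) \<partial>mu u)
        = (\<integral>t. indicator R t + 2 * \<sigma> * (indicator R t * t) \<partial>mu u)"
      by (simp add: expand)
    also have "\<dots> = measure (mu u) R + 2 * \<sigma> * inner (E R v) u"
      using intR by (simp add: cross)
    also have "measure (mu u) R = inner (E R u) u"
      using R by (simp add: measure_def emeasure_mu inner_E_self)
    finally have eq: "(\<integral>t. indicator R t * (1 + 2 * \<sigma> * t) \<partial>mu u)
        = inner (E R u) u + 2 * \<sigma> * inner (E R v) u" .
    have nonneg: "0 \<le> inner (E R u) u + 2 * \<sigma> * inner (E R v) u"
      unfolding eq[symmetric] by (rule integral_nonneg_AE[OF pos])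
    have "inner (E R u) v = inner (E R v) u"
      using R by (metis E_sa inner_commute)
    then have "inner (E R (u + \<sigma> *\<^sub>R v)) (u + \<sigma> *\<^sub>R v)
        = (inner (E R u) u + 2 * \<sigma> * inner (E R v) u) + inner (E R v) v"
      using R by (simp add: E_add E_scaleR inner_add_left inner_add_right distrib_left \<sigma>\<sigma>)
    then show ?thesis
      using R nonneg by (simp add: NR eq emeasure_mu inner_E_self flip: ennreal_plus)
  qed
  then have "(\<integral>t. t \<partial>mu (u + \<sigma> *\<^sub>R v)) = (\<integral>t. t \<partial>N) + (\<integral>t. t \<partial>mu v)"
    using intN int by (intro integral_emeasure_add) (auto simp: N_def)
  moreover have "(u + \<sigma> *\<^sub>R v, v + \<sigma> *\<^sub>R w) \<in> T"
    by (intro T_add T_scaleR uv vw)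
  ultimately have "inner (v + \<sigma> *\<^sub>R w) (u + \<sigma> *\<^sub>R v)
      = inner v u + 2 * \<sigma> * (\<integral>t. t\<^sup>2 \<partial>mu u) + inner w v"
    using N T_form[OF vw] T_form[of "u + \<sigma> *\<^sub>R v" "v + \<sigma> *\<^sub>R w"] by simp
  moreover have "inner w u = inner v v"
    using T_sym[OF vw uv] by simp
  ultimately have "2 * \<sigma> * inner v v = 2 * \<sigma> * (\<integral>t. t\<^sup>2 \<partial>mu u)"
    by (simp add: inner_add_left inner_add_right distrib_left \<sigma>\<sigma>)
  then have "inner v v = (\<integral>t. t\<^sup>2 \<partial>mu u)"
    using \<sigma> by (cases "\<sigma> = 0") simp_all
  then show ?thesis
    by (simp add: dot_square_norm)
qed

text \<open>
  On Borel sets where the floor function is constant, \<open>norm_square_bounded\<close> applies to \<open>E S x\<close>, because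
  \<open>E S\<close> commutes with the operator; countably many of these sets cover the line.
\<close>

theorem mu_image:
  assumes xy: "(x, y) \<in> T"
  shows "mu y = density (mu x) (\<lambda>t. ennreal (t\<^sup>2))"
proof (rule measure_eqI)
  define I where "I n = {t :: real. \<lfloor>t\<rfloor> = int_decode n}" for n
  have I[measurable]: "I n \<in> sets borel" for n
    unfolding I_def by measurable
  fix R assume "R \<in> sets (mu y)"
  then have R[measurable]: "R \<in> sets borel" by simp
  have local: "emeasure (mu y) (R \<inter> I n) = emeasure (density (mu x) (\<lambda>t. ennreal (t\<^sup>2))) (R \<inter> I n)"
    for n
  proof -
    define S where "S = R \<inter> I n"
    have S[measurable]: "S \<in> sets borel" unfolding S_def by auto
    define \<sigma> :: real where "\<sigma> = (if int_decode n \<ge> 0 then 1 else - 1)"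
    have "(norm (E S y))\<^sup>2 = (\<integral>t. t\<^sup>2 \<partial>mu (E S x))"
    proof (rule norm_square_bounded[OF S _ _ _ E_commute[OF S xy]])
      show "\<bar>t\<bar> \<le> \<bar>real_of_int (int_decode n)\<bar> + 1" if "t \<in> S" for t
      proof -
        have "\<lfloor>t\<rfloor> = int_decode n" using that by (simp add: S_def I_def)
        then show ?thesis by linarith
      qed
      show "\<bar>t\<bar> = \<sigma> * t" if "t \<in> S" for t
      proof -
        have "\<lfloor>t\<rfloor> = int_decode n" using that by (simp add: S_def I_def)
        then show ?thesis by (auto simp: \<sigma>_def) linarith+
      qed
      show "\<sigma> * \<sigma> = 1" by (simp add: \<sigma>_def)
      show "E S (E S x) = E S x" by (simp add: E_idem)
    qed
    moreover have "integrable (mu x) (\<lambda>t. indicator S t * t\<^sup>2)"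
      using integrable_real_mult_indicator[of S "mu x" "\<lambda>t. t\<^sup>2"] integrable_square[OF xy]
      by (simp add: mult.commute)
    ultimately have "ennreal ((norm (E S y))\<^sup>2) = (\<integral>\<^sup>+t. ennreal (indicator S t * t\<^sup>2) \<partial>mu x)"
      by (simp add: integral_mu_E nn_integral_eq_integral)
    also have "\<dots> = emeasure (density (mu x) (\<lambda>t. ennreal (t\<^sup>2))) S"
      by (subst emeasure_density) (auto intro!: nn_integral_cong split: split_indicator)
    finally show ?thesis
      by (simp add: emeasure_mu_norm S_def)
  qed
  have un: "(\<Union>n. R \<inter> I n) = R"
    unfolding I_def using surj_int_decode by (auto simp: surj_def)
  have dj: "disjoint_family (\<lambda>n. R \<inter> I n)"
    by (auto simp: disjoint_family_on_def I_def) (metis int_decode_inverse)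
  have "emeasure (mu y) R = (\<Sum>n. emeasure (mu y) (R \<inter> I n))"
    using suminf_emeasure[of "\<lambda>n. R \<inter> I n" "mu y"] dj un by (simp add: image_subset_iff)
  also have "\<dots> = emeasure (density (mu x) (\<lambda>t. ennreal (t\<^sup>2))) R"
    using suminf_emeasure[of "\<lambda>n. R \<inter> I n" "density (mu x) (\<lambda>t. ennreal (t\<^sup>2))"] dj un
    by (simp add: image_subset_iff local)
  finally show "emeasure (mu y) R = emeasure (density (mu x) (\<lambda>t. ennreal (t\<^sup>2))) R" .
qed simp

context
  fixes v :: "nat \<Rightarrow> 'h"
  assumes v: "\<And>i. (v i, v (Suc i)) \<in> T"
begin

lemma mu_iterate: "mu (v k) = density (mu (v 0)) (\<lambda>t. ennreal (t ^ (2 * k)))"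
proof (induction k)
  case 0
  then show ?case by (simp add: density_1)
next
  case (Suc k)
  then show ?case
    by (simp add: mu_image[OF v] density_density_eq power2_eq_square algebra_simps
        flip: ennreal_mult')
qed

text \<open>
  The measure of the \<open>k\<close>-th iterate is finite and has density \<open>t ^ (2 * k)\<close>, so \<open>t ^ k\<close> is square
  integrable.
\<close>

lemma moment_integrable: "integrable (mu (v 0)) (\<lambda>t. t ^ k)"
proof -
  interpret finite_measure "mu (v 0)" by (rule finite_measure_mu)
  have "integrable (mu (v k)) (\<lambda>t. 1 :: real)"
    by (rule integrable_mu_bounded[where B = 1]) auto
  then have "integrable (mu (v 0)) (\<lambda>t. t ^ (2 * k))"
    unfolding mu_iterate[of k] by (subst (asm) integrable_density) simp_all
  then have "integrable (mu (v 0)) (\<lambda>t. (t ^ k)\<^sup>2)"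
    by (simp add: power_mult[symmetric] mult.commute)
  then show ?thesis
    by (rule square_integrable_imp_integrable[rotated]) simp
qed

lemma inner_shift: "inner (v (i + k)) (v j) = inner (v i) (v (j + k))"
proof (induction k arbitrary: j)
  case (Suc k)
  have "inner (v (Suc (i + k))) (v j) = inner (v (i + k)) (v (Suc j))"
    using T_sym[OF v v] .
  with Suc[of "Suc j"] show ?case by simp
qed simp

text \<open>
  By symmetry of the operator the inner product can be balanced to one between iterates whose indices
  are equal or differ by one: a norm or a value of the quadratic form at the iterate \<open>m\<close>.
\<close>

lemma moment: "inner (v 0) (v k) = (\<integral>t. t ^ k \<partial>mu (v 0))"
proof -
  obtain m where "k = 2 * m \<or> k = 2 * m + 1"
    by (metis oddE evenE)
  then show ?thesis
  proof
    assume k: "k = 2 * m"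
    then have "inner (v 0) (v k) = inner (v m) (v m)"
      using inner_shift[of 0 m m] by (simp add: mult_2)
    also have "\<dots> = (\<integral>t. 1 \<partial>mu (v m))"
      by (simp add: measure_def emeasure_mu E_UNIV)
    also have "\<dots> = (\<integral>t. t ^ k \<partial>mu (v 0))"
      unfolding mu_iterate[of m] k by (subst integral_density) simp_all
    finally show ?thesis .
  next
    assume k: "k = 2 * m + 1"
    then have "inner (v 0) (v k) = inner (v (Suc m)) (v m)"
      using inner_shift[of 0 m "Suc m"] by (simp add: mult_2 inner_commute)
    also have "\<dots> = (\<integral>t. t \<partial>mu (v m))"
      using T_form[OF v] .
    also have "\<dots> = (\<integral>t. t ^ k \<partial>mu (v 0))"
      unfolding mu_iterate[of m] k by (subst integral_density) (simp_all add: mult.commute[of "_ ^ (2 * m)"])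
    finally show ?thesis .
  qed
qed

end

end

section \<open>Orthonormality of the Jacobi polynomials under the spectral measure\<close>

text \<open>
  The vectors \<open>e k\<close> are an orthonormal system on which \<open>T\<close> acts as the Jacobi matrix, and the \<open>v i\<close> are
  the iterates of \<open>e 0\<close> under \<open>T\<close>.
\<close>

locale jacobi_spectral = spectral_resolution E T + jacobi_parameters a b
  for E :: "real set \<Rightarrow> 'h \<Rightarrow> 'h :: real_inner" and T a b +
  fixes e v :: "nat \<Rightarrow> 'h"
  assumes e_T: "(e k, jacobi_action a b e k) \<in> T"
    and e_orthonormal: "inner (e j) (e k) = (if j = k then 1 else 0)"
    and v_0: "v 0 = e 0"
    and v_T: "(v i, v (Suc i)) \<in> T"
begin

lemma integrable_poly: "integrable (mu (e 0)) (\<lambda>t. poly p t)"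
  unfolding poly_altdef
  using moment_integrable[of v, OF v_T] by (simp add: v_0)

lemma inner_jacobi_action:
  "inner (jacobi_action a b e k) w = jacobi_action a b (\<lambda>k. inner (e k) w) k"
  by (simp add: jacobi_action_def inner_add_left)

lemma integral_jacobi_action:
  fixes q :: "real poly"
  shows "jacobi_action a b (\<lambda>k. \<integral>t. poly (orth_poly a b k) t * poly q t \<partial>mu (e 0)) k
    = (\<integral>t. t * poly (orth_poly a b k) t * poly q t \<partial>mu (e 0))"
proof -
  have int: "integrable (mu (e 0)) (\<lambda>t. poly (orth_poly a b k) t * poly q t)" for k
    using integrable_poly[of "orth_poly a b k * q"] by (simp del: orth_poly.simps)
  have pointwise: "jacobi_action a b (\<lambda>k. poly (orth_poly a b k) t * poly q t) k
      = t * poly (orth_poly a b k) t * poly q t" for t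
  proof -
    have "jacobi_action a b (\<lambda>k. poly (orth_poly a b k) t * poly q t) k
        = jacobi_action a b (\<lambda>k. poly (orth_poly a b k) t) k * poly q t"
      by (simp add: jacobi_action_def distrib_right)
    then show ?thesis by (simp only: orth_poly_recurrence)
  qed
  have "jacobi_action a b (\<lambda>k. \<integral>t. poly (orth_poly a b k) t * poly q t \<partial>mu (e 0)) k
      = (\<integral>t. jacobi_action a b (\<lambda>k. poly (orth_poly a b k) t * poly q t) k \<partial>mu (e 0))"
    by (rule jacobi_action_integral[OF int])
  also have "\<dots> = (\<integral>t. t * poly (orth_poly a b k) t * poly q t \<partial>mu (e 0))"
    by (simp only: pointwise)
  finally show ?thesis .
qed

text \<open>
  For \<open>k = 0\<close> these are the moments. In the induction step, moving the operator from \<open>e k\<close> to \<open>v i\<close>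
  raises \<open>i\<close> by one, and so does the factor \<open>t\<close> from the recurrence of the polynomials.
\<close>

lemma inner_e_iterate:
  "inner (e k) (v i) = (\<integral>t. poly (orth_poly a b k) t * t ^ i \<partial>mu (e 0))"
proof (induction k arbitrary: i rule: less_induct)
  case (less k)
  show ?case
  proof (cases k)
    case 0
    then show ?thesis
      using moment[of v, OF v_T, of i] by (simp add: v_0)
  next
    case (Suc m)
    let ?F = "\<lambda>j i. \<integral>t. poly (orth_poly a b j) t * t ^ i \<partial>mu (e 0)"
    have "inner (e (Suc m)) (v i) = ?F (Suc m) i"
    proof (rule jacobi_action_step[where f = "\<lambda>j. inner (e j) (v i)" and g = "\<lambda>j. ?F j i"])
      have "jacobi_action a b (\<lambda>j. inner (e j) (v i)) m = inner (e m) (v (Suc i))"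
        using T_sym[OF e_T v_T] by (simp add: inner_jacobi_action)
      also have "\<dots> = ?F m (Suc i)"
        using less Suc by simp
      also have "\<dots> = jacobi_action a b (\<lambda>j. ?F j i) m"
        using integral_jacobi_action[of "monom 1 i" m] by (simp add: poly_monom mult_ac)
      finally show "jacobi_action a b (\<lambda>j. inner (e j) (v i)) m = jacobi_action a b (\<lambda>j. ?F j i) m" .
    qed (use less Suc in simp_all)
    then show ?thesis using Suc by simp
  qed
qed

text \<open>
  On each side the Jacobi action in the index \<open>j\<close> gives the same result as the one in \<open>k\<close>: on the left
  by symmetry of the operator, on the right because either action multiplies the integrand by \<open>t\<close>.
  This determines both sides from their values at \<open>j = 0\<close>, which agree by \<open>inner_e_iterate\<close>.
\<close>

lemma inner_e:
  "inner (e j) (e k) = (\<integral>t. poly (orth_poly a b j) t * poly (orth_poly a b k) t \<partial>mu (e 0))"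
proof (induction j arbitrary: k rule: less_induct)
  case (less j)
  show ?case
  proof (cases j)
    case 0
    then show ?thesis
      using inner_e_iterate[of k 0] by (simp add: v_0 inner_commute)
  next
    case (Suc m)
    let ?F = "\<lambda>j k. \<integral>t. poly (orth_poly a b j) t * poly (orth_poly a b k) t \<partial>mu (e 0)"
    have sym: "?F j k = ?F k j" for j k
      by (simp add: mult.commute)
    have "inner (e (Suc m)) (e k) = ?F (Suc m) k"
    proof (rule jacobi_action_step[where f = "\<lambda>j. inner (e j) (e k)" and g = "\<lambda>j. ?F j k"])
      have "jacobi_action a b (\<lambda>j. inner (e j) (e k)) m = inner (e m) (jacobi_action a b e k)"
        using T_sym[OF e_T e_T, of m k] by (simp add: inner_jacobi_action)
      also have "\<dots> = jacobi_action a b (\<lambda>k. inner (e m) (e k)) k"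
        using inner_jacobi_action[of k "e m"] by (simp add: inner_commute)
      also have "\<dots> = jacobi_action a b (\<lambda>k. ?F k m) k"
        using less.IH[of m] Suc sym by simp
      also have "\<dots> = jacobi_action a b (\<lambda>j. ?F j k) m"
        by (simp add: integral_jacobi_action mult_ac)
      finally show "jacobi_action a b (\<lambda>j. inner (e j) (e k)) m = jacobi_action a b (\<lambda>j. ?F j k) m" .
    qed (use less Suc in simp_all)
    then show ?thesis using Suc by simp
  qed
qed

theorem jacobi_orthonormal_mu: "jacobi_orthonormal a b (mu (e 0))"
proof
  show "integrable (mu (e 0)) (\<lambda>x. poly (orth_poly a b j) x * poly (orth_poly a b k) x)" for j k
    using integrable_poly[of "orth_poly a b j * orth_poly a b k"] by simp
  show "(\<integral>x. poly (orth_poly a b j) x * poly (orth_poly a b k) x \<partial>mu (e 0)) = (if j = k then 1 else 0)" for j k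
    using inner_e[of j k] by (simp add: e_orthonormal)
qed simp

end

lift_definition ell2_basis :: "nat \<Rightarrow> ell2" is "\<lambda>k n. if n = k then 1 else 0"
  by (rule summable_finite[of "{k}" for k]) auto

lemma ell2_basis_0: "ell2_basis 0 = e0"
  by (rule ell2_eqI) (simp add: ell2_basis.rep_eq e0.rep_eq)

lemma inner_ell2_basis: "inner (ell2_basis j) (ell2_basis k) = (if j = k then 1 else 0)"
proof -
  have "cinner (ell2_basis j) (ell2_basis k) = (\<Sum>n\<in>{j}. coord (ell2_basis j) n * cnj (coord (ell2_basis k) n))"
    unfolding cinner.rep_eq by (rule suminf_finite) (auto simp: ell2_basis.rep_eq)
  then show ?thesis by (simp add: inner_ell2_def ell2_basis.rep_eq)
qed

lemma scaleR_eq_scaleC: "r *\<^sub>R x = scaleC_ell2 (complex_of_real r) x"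
  by (rule ell2_eqI) (simp add: scaleR_ell2.rep_eq scaleC_ell2.rep_eq)

lemma jacobi_operatorI:
  assumes "finite {n. coord x n \<noteq> 0}"
    and "\<And>i. coord y i = (\<Sum>j. complex_of_real (jacobi_matrix a b i j) * coord x j)"
  shows "(x, y) \<in> jacobi_operator a b"
  unfolding jacobi_operator_def using assms by (intro subsetD[OF closure_subset]) simp

lemma jacobi_operator_basis: "(ell2_basis k, jacobi_action a b ell2_basis k) \<in> jacobi_operator a b"
proof (rule jacobi_operatorI)
  have "{n. coord (ell2_basis k) n \<noteq> 0} \<subseteq> {k}"
    by (auto simp: ell2_basis.rep_eq)
  then show "finite {n. coord (ell2_basis k) n \<noteq> 0}"
    using finite_subset by blast
  fix i
  have "(\<Sum>j. complex_of_real (jacobi_matrix a b i j) * coord (ell2_basis k) j)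
      = (\<Sum>j\<in>{k}. complex_of_real (jacobi_matrix a b i j) * coord (ell2_basis k) j)"
    by (rule suminf_finite) (auto simp: ell2_basis.rep_eq)
  then show "coord (jacobi_action a b ell2_basis k) i
      = (\<Sum>j. complex_of_real (jacobi_matrix a b i j) * coord (ell2_basis k) j)"
    by (auto simp: jacobi_action_def jacobi_matrix_def plus_ell2.rep_eq scaleR_ell2.rep_eq
        zero_ell2.rep_eq ell2_basis.rep_eq)
qed

text \<open>
  The Jacobi matrix enlarges the support by at most one index, so finitely supported vectors can be
  iterated indefinitely within the domain.
\<close>

lemma jacobi_operator_finite_support:
  assumes "finite {n. coord x n \<noteq> 0}"
  shows "\<exists>y. (x, y) \<in> jacobi_operator a b \<and> finite {n. coord y n \<noteq> 0}"
proof -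
  obtain N where N: "\<And>n. coord x n \<noteq> 0 \<Longrightarrow> n < N"
    using assms by (auto simp: finite_nat_set_iff_bounded)
  define y where "y i = (\<Sum>j. complex_of_real (jacobi_matrix a b i j) * coord x j)" for i
  have y0: "y i = 0" if "i > N" for i
  proof -
    have "complex_of_real (jacobi_matrix a b i j) * coord x j = 0" for j
      using N[of j] that by (cases "coord x j = 0") (auto simp: jacobi_matrix_def)
    then show ?thesis unfolding y_def by (simp only: suminf_zero)
  qed
  have "summable (\<lambda>n. (cmod (y n))\<^sup>2)"
    by (rule summable_finite[of "{..N}"]) (auto simp: y0)
  then have coord: "coord (Abs_ell2 y) = y"
    by (simp add: Abs_ell2_inverse)
  have "{n. y n \<noteq> 0} \<subseteq> {..N}"
    using y0 by (force simp: not_less[symmetric])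
  then have "finite {n. coord (Abs_ell2 y) n \<noteq> 0}"
    unfolding coord using finite_subset by blast
  moreover have "(x, Abs_ell2 y) \<in> jacobi_operator a b"
    by (rule jacobi_operatorI[OF assms]) (simp add: coord y_def)
  ultimately show ?thesis by blast
qed

lemma jacobi_operator_iterates:
  "\<exists>v. v 0 = ell2_basis 0 \<and> (\<forall>i::nat. (v i, v (Suc i)) \<in> jacobi_operator a b)"
proof -
  have "\<exists>v. \<forall>i::nat. (finite {n. coord (v i) n \<noteq> 0} \<and> (i = 0 \<longrightarrow> v i = ell2_basis 0))
      \<and> (v i, v (Suc i)) \<in> jacobi_operator a b"
  proof (rule dependent_nat_choice)
    show "\<exists>x. finite {n. coord x n \<noteq> 0} \<and> (0 = (0::nat) \<longrightarrow> x = ell2_basis 0)"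
      by (intro exI[of _ "ell2_basis 0"]) (simp add: ell2_basis.rep_eq)
    show "\<exists>y. (finite {n. coord y n \<noteq> 0} \<and> (Suc n = 0 \<longrightarrow> y = ell2_basis 0)) \<and> (x, y) \<in> jacobi_operator a b"
      if "finite {n. coord x n \<noteq> 0} \<and> (n = 0 \<longrightarrow> x = ell2_basis 0)" for x and n :: nat
      using jacobi_operator_finite_support that by blast
  qed
  then show ?thesis by blast
qed

lemma spectral_resolution_self_adjoint:
  assumes sa: "self_adjoint A" and sp: "spectral_measure_of A E"
  shows "spectral_resolution E A"
    and "spectral_family.mu E x = scalar_spectral_measure E x"
proof -
  have pvm: "projection_valued_measure E"
    using sp by (simp add: spectral_measure_of_def)
  then have proj: "orthogonal_projection (E S)" if "S \<in> sets borel" for S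
    using that by (simp add: projection_valued_measure_def)
  interpret spectral_family E
  proof
    fix S :: "real set" and x y :: ell2 and r :: real
    assume "S \<in> sets borel"
    note P = proj[OF this, unfolded orthogonal_projection_def]
    show "E S (x + y) = E S x + E S y" "E S (r *\<^sub>R x) = r *\<^sub>R E S x"
      "inner (E S x) y = inner x (E S y)"
      using P by (simp_all add: scaleR_eq_scaleC inner_ell2_def)
  qed (use pvm in \<open>auto simp: projection_valued_measure_def\<close>)
  show mu: "mu x = scalar_spectral_measure E x" for x
    by (simp add: mu_def scalar_spectral_measure_def inner_ell2_def)
  have lin: "linear_operator A" and adj: "adjoint_operator A = A"
    using sa by (simp_all add: self_adjoint_def)
  show "spectral_resolution E A"
  proof
    fix x y u v :: ell2 and r :: real
    assume xy: "(x, y) \<in> A"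
    show "(x + u, y + v) \<in> A" if "(u, v) \<in> A"
      using lin xy that unfolding linear_operator_def by fast
    show "(r *\<^sub>R x, r *\<^sub>R y) \<in> A"
      using lin xy unfolding linear_operator_def scaleR_eq_scaleC by fast
    show "y = v" if "(x, v) \<in> A"
      using lin xy that unfolding linear_operator_def single_valued_def by blast
    show "inner y u = inner x v" if "(u, v) \<in> A"
    proof -
      have "(u, v) \<in> adjoint_operator A" using that adj by simp
      then have "cinner y u = cinner x v"
        using xy unfolding adjoint_operator_def by blast
      then show ?thesis by (simp add: inner_ell2_def)
    qed
    have "cinner y x = complex_of_real (\<integral>t. t \<partial>scalar_spectral_measure E x)"
      using sp xy unfolding spectral_measure_of_def by blast
    then show "inner y x = (\<integral>t. t \<partial>mu x)"
      by (simp add: inner_ell2_def mu)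
  next
    show "closure (Domain A) = UNIV"
      using sa by (simp add: self_adjoint_def)
    show "Domain A = {x. integrable (mu x) power2}"
      using sp by (simp add: spectral_measure_of_def mu)
  qed
qed

theorem jacobi_orthonormal_spectral_measure:
  assumes "\<And>n. a n > 0" and "self_adjoint A" and "jacobi_operator a b \<subseteq> A"
    and "spectral_measure_of A E"
  shows "jacobi_orthonormal a b (spectral_measure_e0 E)"
proof -
  interpret spectral_resolution E A
    by (rule spectral_resolution_self_adjoint[OF assms(2,4)])
  obtain v where v: "v 0 = ell2_basis 0" "\<And>i. (v i, v (Suc i)) \<in> A"
    using jacobi_operator_iterates[of a b] assms(3) by blast
  interpret jacobi_spectral E A a b ell2_basis v
    by unfold_locales (use assms(1,3) v jacobi_operator_basis inner_ell2_basis in auto)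
  show ?thesis
    using jacobi_orthonormal_mu
    by (simp add: ell2_basis_0 spectral_measure_e0_def spectral_resolution_self_adjoint(2)[OF assms(2,4)])
qed

section \<open>Convergence of the Cauchy transforms\<close>

lemma cauchy_transform_scale_measure:
  assumes "r \<ge> 0" and "sets M = sets borel"
  shows "cauchy_transform (scale_measure (ennreal r) M) z = complex_of_real r * cauchy_transform M z"
proof -
  have [measurable_cong]: "sets M = sets borel" by fact
  have "scale_measure (ennreal r) M = density M (\<lambda>_. ennreal r)"
    by (rule measure_eqI) (simp_all add: emeasure_density_const)
  then have "cauchy_transform (scale_measure (ennreal r) M) z
      = (\<integral>x. r *\<^sub>R (1 / (complex_of_real x - z)) \<partial>M)"
    unfolding cauchy_transform_def using assms(1)
    by (simp only:) (rule integral_density, simp_all)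
  also have "\<dots> = r *\<^sub>R cauchy_transform M z"
    unfolding cauchy_transform_def by (rule integral_scaleR_right)
  finally show ?thesis by (simp only: scaleR_conv_of_real)
qed

lemma locally_uniform_limit_off_real:
  fixes f :: "nat \<Rightarrow> complex \<Rightarrow> real"
  assumes bound: "\<And>n z. Im z \<noteq> 0 \<Longrightarrow> \<bar>f n z\<bar> \<le> 1 / \<rho> n * (C / \<bar>Im z\<bar>)"
    and \<rho>: "\<And>n. \<rho> n > 0" "filterlim \<rho> at_top sequentially" and "C \<ge> 0"
  shows "locally_uniform_limit (- \<real>) f (\<lambda>_. 0) sequentially"
  unfolding locally_uniform_limit_def
proof
  fix z :: complex assume "z \<in> - \<real>"
  then have z: "Im z \<noteq> 0" by (auto simp: complex_is_Real_iff)
  \<comment> \<open>A neighbourhood of \<open>z\<close> that stays at a positive distance from the real line.\<close>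
  define U where "U = {w. \<bar>Im z\<bar> / 2 < \<bar>Im w\<bar>}"
  have "open U"
    unfolding U_def by (intro open_Collect_less continuous_intros)
  moreover have "z \<in> U" using z by (simp add: U_def)
  moreover have "uniform_limit (U \<inter> - \<real>) f (\<lambda>_. 0) sequentially"
  proof (rule uniform_limitI)
    fix e :: real assume e: "e > 0"
    define B where "B = C / (\<bar>Im z\<bar> / 2)"
    have "eventually (\<lambda>n. \<rho> n > B / e) sequentially"
      using \<rho>(2) by (simp add: filterlim_at_top_dense)
    then show "\<forall>\<^sub>F n in sequentially. \<forall>w\<in>U \<inter> - \<real>. dist (f n w) 0 < e"
    proof (eventually_elim, intro ballI)
      fix n w assume n: "\<rho> n > B / e" and w: "w \<in> U \<inter> - \<real>"
      then have "\<bar>Im z\<bar> / 2 < \<bar>Im w\<bar>" by (simp add: U_def)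
      then have "C / \<bar>Im w\<bar> \<le> B"
        unfolding B_def using z assms(4) by (intro divide_left_mono) auto
      then have "1 / \<rho> n * (C / \<bar>Im w\<bar>) \<le> 1 / \<rho> n * B"
        using \<rho>(1)[of n] by (intro mult_left_mono) auto
      also have "\<dots> < e"
        using n e \<rho>(1)[of n] by (simp add: field_simps)
      finally have "1 / \<rho> n * (C / \<bar>Im w\<bar>) < e" .
      moreover have "Im w \<noteq> 0" using \<open>\<bar>Im z\<bar> / 2 < \<bar>Im w\<bar>\<close> by auto
      ultimately show "dist (f n w) 0 < e"
        using bound[of w n] by simp
    qed
  qed
  ultimately show "\<exists>U. open U \<and> z \<in> U \<and> uniform_limit (U \<inter> - \<real>) f (\<lambda>_. 0) sequentially"
    by blast
qed

theorem theorem6: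
  fixes a b \<rho> :: "nat \<Rightarrow> real"
    and A :: "(ell2 \<times> ell2) set"
    and E :: "real set \<Rightarrow> ell2 \<Rightarrow> ell2"
  assumes "\<And>n. a n > 0"
    and "self_adjoint A"
    and "jacobi_operator a b \<subseteq> A"
    and "spectral_measure_of A E"
    and "\<And>n. \<rho> n > 0"
    and "filterlim \<rho> at_top sequentially"
  shows "locally_uniform_limit (- \<real>)
           (\<lambda>n z. cmod (cauchy_transform (scale_measure (ennreal (1 / \<rho> n)) (nu_measure a b n)) z
                      - cauchy_transform (scale_measure (ennreal (1 / \<rho> n)) (eta_measure a b E n)) z))
           (\<lambda>_. 0) sequentially
       \<and> (\<forall>L. locally_uniform_limit (- \<real>)
           (\<lambda>n z. cmod (cauchy_transform (scale_measure (ennreal (1 / \<rho> n)) (eta_measure a b E (n + L))) z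
                      - cauchy_transform (scale_measure (ennreal (1 / \<rho> n)) (eta_measure a b E n)) z))
           (\<lambda>_. 0) sequentially)"
proof -
  interpret jacobi_orthonormal a b "spectral_measure_e0 E"
    using assms by (intro jacobi_orthonormal_spectral_measure)
  have sets: "sets (nu_measure a b n) = sets borel" "sets (eta_measure a b E n) = sets borel" for n
    by (simp_all add: nu_measure_eq_distr eta_measure_def)
  have eta: "cauchy_transform (eta_measure a b E n) z = (\<Sum>k\<le>n. green z k k)" if "Im z \<noteq> 0" for n z
    unfolding eta_measure_def by (rule cauchy_transform_kernel_density[OF that])
  have scale: "cmod (cauchy_transform (scale_measure (ennreal (1 / \<rho> n)) M) z
      - cauchy_transform (scale_measure (ennreal (1 / \<rho> n)) N) z)
    = 1 / \<rho> n * cmod (cauchy_transform M z - cauchy_transform N z)"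
    if "sets M = sets borel" "sets N = sets borel" for M N n z
  proof -
    have "1 / \<rho> n \<ge> 0" using assms(5)[of n] by simp
    then show ?thesis
      using that by (simp only: cauchy_transform_scale_measure norm_mult norm_of_real abs_of_nonneg
          flip: right_diff_distrib)
  qed
  have "locally_uniform_limit (- \<real>)
      (\<lambda>n z. 1 / \<rho> n * cmod (cauchy_transform (nu_measure a b n) z - cauchy_transform (eta_measure a b E n) z))
      (\<lambda>_. 0) sequentially"
  proof (rule locally_uniform_limit_off_real[where C = 1, OF _ assms(5,6)])
    fix n and z :: complex assume z: "Im z \<noteq> 0"
    show "\<bar>1 / \<rho> n * cmod (cauchy_transform (nu_measure a b n) z - cauchy_transform (eta_measure a b E n) z)\<bar>
        \<le> 1 / \<rho> n * (1 / \<bar>Im z\<bar>)"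
      using divide_right_mono[OF cauchy_transform_nu_eta_bound[OF z, of n], of "\<rho> n"] assms(5)[of n]
      by (simp add: eta[OF z] abs_mult mult.commute)
  qed simp
  moreover have "locally_uniform_limit (- \<real>)
      (\<lambda>n z. 1 / \<rho> n * cmod (cauchy_transform (eta_measure a b E (n + L)) z - cauchy_transform (eta_measure a b E n) z))
      (\<lambda>_. 0) sequentially" for L
  proof (rule locally_uniform_limit_off_real[where C = L, OF _ assms(5,6)])
    fix n and z :: complex assume z: "Im z \<noteq> 0"
    have "(\<Sum>k\<le>n + L. green z k k) = (\<Sum>k\<le>n. green z k k) + (\<Sum>k\<in>{n<..n + L}. green z k k)"
      by (subst sum.union_disjoint[symmetric]) (auto intro: sum.cong)
    then have "cmod (cauchy_transform (eta_measure a b E (n + L)) z - cauchy_transform (eta_measure a b E n) z)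
        = cmod (\<Sum>k\<in>{n<..n + L}. green z k k)"
      by (simp add: eta[OF z])
    also have "\<dots> \<le> (\<Sum>k\<in>{n<..n + L}. 1 / \<bar>Im z\<bar>)"
      by (rule sum_norm_le) (rule norm_green_diagonal[OF z])
    also have "\<dots> = L / \<bar>Im z\<bar>" by simp
    finally have "cmod (cauchy_transform (eta_measure a b E (n + L)) z - cauchy_transform (eta_measure a b E n) z)
        \<le> L / \<bar>Im z\<bar>" .
    from divide_right_mono[OF this, of "\<rho> n"]
    show "\<bar>1 / \<rho> n * cmod (cauchy_transform (eta_measure a b E (n + L)) z
        - cauchy_transform (eta_measure a b E n) z)\<bar> \<le> 1 / \<rho> n * (L / \<bar>Im z\<bar>)"
      using assms(5)[of n] by (simp add: abs_mult mult.commute)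
  qed simp
  ultimately show ?thesis
    unfolding scale[OF sets(1) sets(2)] scale[OF sets(2) sets(2)] by blast
qed

end
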